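(* Let $w\in\mathfrak{S}_n$ and let $Y_w$ be the closure of a generic $T$-orbit in the Schubert variety $X_w$. For every $u\in\mathfrak{S}_n$ with $u\le w$, the maximal cone in the fan of the toric variety $Y_w$ corresponding to the $T$-fixed point $uB$ is the image, under the projection $\mathbb{R}^n\to\mathbb{R}^n/F_w$, of the union $$\bigcup_{v\in\mathfrak{S}_n,\ v'=u} C(v).$$
   Context: Let $G=\mathrm{GL}_n(\mathbb{C})$, $B\subset G$ the Borel subgroup of upper triangular matrices, and $T\subset B$ the torus of diagonal matrices, acting on the flag variety $G/B$ by left multiplication. A permutation $w\in\mathfrak{S}_n$ (written in one-line notation $w(1)w(2)\cdots w(n)$) is identified with the permutation matrix whose $i$-th column is the standard basis vector $e_{w(i)}$. $\le$ denotes the Bruhat order on $\mathfrak{S}_n$. The Schubert variety is $X_w=\overline{BwB/B}$; it is $T$-invariant and its $T$-fixed points are exactly the points $uB$ with $u\le w$. A $T$-orbit in $X_w$ is called generic if its closure contains all $T$-fixed points of $X_w$, and $Y_w$ denotes the closure of a generic $T$-orbit in $X_w$; it is a (normal) toric variety. One-parameter subgroups $\mathbb{C}^*\to T$ are identified with $\mathbb{Z}^n$ via $a=(a_1,\dots,a_n)\mapsto \lambda^a(t)=\mathrm{diag}(t^{a_1},\dots,t^{a_n})$, so $\mathrm{Hom}(\mathbb{C}^*,T)\otimes\mathbb{R}=\mathbb{R}^n$. Let $T_w\subset T$ be the subtorus fixing $Y_w$ pointwise and $F_w=\mathrm{Hom}(\mathbb{C}^*,T_w)\otimes\mathbb{R}\subset\mathbb{R}^n$;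 the fan of $Y_w$ lives in $\mathbb{R}^n/F_w$, and maximal cones correspond to $T$-fixed points via the orbit–cone correspondence. For $v\in\mathfrak{S}_n$, $C(v)=\{(a_1,\dots,a_n)\in\mathbb{R}^n : a_{v(1)}\le a_{v(2)}\le\cdots\le a_{v(n)}\}$. For a set $\{a_1,\dots,a_d\}$ of integers, $\{a_1,\dots,a_d\}\!\uparrow$ denotes the $d$-tuple of its elements in increasing order; $w^{(d)}=\{w(1),\dots,w(d)\}\!\uparrow$. Increasing $d$-tuples are compared by $(i_1,\dots,i_d)\le(j_1,\dots,j_d)$ iff $i_t\le j_t$ for all $t$. For fixed $w$ and $v\in\mathfrak{S}_n$ define inductively $i_1=\min\{i\in[n]: v(i)\le w(1)\}$ and, for $k=2,\dots,n$, $i_k=\min\{i\in[n]\setminus\{i_1,\dots,i_{k-1}\} : \{v(i_1),\dots,v(i_{k-1}),v(i)\}\!\uparrow\le w^{(k)}\}$; then $v'=v(i_1)v(i_2)\cdots v(i_n)\in\mathfrak{S}_n$ (this operation depends on $w$). *)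

theory Defs
  imports
    "HOL-Analysis.Function_Topology"
    "HOL-Combinatorics.Permutations"
    "Jordan_Normal_Form.VS_Connect"
begin

text \<open>
  Indices start at 0: \<open>[n]\<close> is \<open>{..<n}\<close>, \<open>w permutes {..<n}\<close> says that \<open>w\<close> lies in the symmetric
  group, and the one-line notation of \<open>w\<close> is \<open>w 0, \<dots>, w (n - 1)\<close>.
\<close>

section \<open>Permutations\<close>

definition perm_length :: "nat \<Rightarrow> (nat \<Rightarrow> nat) \<Rightarrow> nat" where
  "perm_length n v = card {(i, j). i < j \<and> j < n \<and> v j < v i}"

definition bruhat_step :: "nat \<Rightarrow> (nat \<Rightarrow> nat) \<Rightarrow> (nat \<Rightarrow> nat) \<Rightarrow> bool" where
  "bruhat_step n u v \<longleftrightarrow>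
     (\<exists>i j. i < j \<and> j < n \<and> v = u \<circ> Transposition.transpose i j \<and> perm_length n u < perm_length n v)"

definition bruhat_le :: "nat \<Rightarrow> (nat \<Rightarrow> nat) \<Rightarrow> (nat \<Rightarrow> nat) \<Rightarrow> bool" where
  "bruhat_le n = (bruhat_step n)\<^sup>*\<^sup>*"

definition tuple_le :: "nat set \<Rightarrow> nat set \<Rightarrow> bool" where
  "tuple_le A B \<longleftrightarrow> list_all2 (\<le>) (sorted_list_of_set A) (sorted_list_of_set B)"

text \<open>\<open>greedy_indices n w v k\<close> is the list \<open>[i\<^sub>1, \<dots>, i\<^sub>k]\<close>, and \<open>greedy_perm n w v\<close> is \<open>v'\<close>.\<close>

primrec greedy_indices :: "nat \<Rightarrow> (nat \<Rightarrow> nat) \<Rightarrow> (nat \<Rightarrow> nat) \<Rightarrow> nat \<Rightarrow> nat list" where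
  "greedy_indices n w v 0 = []"
| "greedy_indices n w v (Suc k) =
     (let is = greedy_indices n w v k
      in is @ [Min {i \<in> {..<n} - set is. tuple_le (insert (v i) (v ` set is)) (w ` {..<Suc k})}])"

definition greedy_perm :: "nat \<Rightarrow> (nat \<Rightarrow> nat) \<Rightarrow> (nat \<Rightarrow> nat) \<Rightarrow> nat \<Rightarrow> nat" where
  "greedy_perm n w v j = (if j < n then v (greedy_indices n w v n ! j) else j)"

definition weyl_chamber :: "nat \<Rightarrow> (nat \<Rightarrow> nat) \<Rightarrow> real vec set" where
  "weyl_chamber n v = {a \<in> carrier_vec n. \<forall>i j. i \<le> j \<and> j < n \<longrightarrow> a $ v i \<le> a $ v j}"


section \<open>The flag variety and its Zariski topology\<close>

definition GL :: "nat \<Rightarrow> complex mat set" where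
  "GL n = {g \<in> carrier_mat n n. invertible_mat g}"

definition borel_subgroup :: "nat \<Rightarrow> complex mat set" where
  "borel_subgroup n = {g \<in> GL n. upper_triangular g}"

definition torus :: "nat \<Rightarrow> complex mat set" where
  "torus n = {g \<in> GL n. diagonal_mat g}"

definition perm_mat :: "nat \<Rightarrow> (nat \<Rightarrow> nat) \<Rightarrow> complex mat" where
  "perm_mat n w = mat n n (\<lambda>(i, j). if i = w j then 1 else 0)"

definition coset :: "nat \<Rightarrow> complex mat \<Rightarrow> complex mat set" where
  "coset n g = (\<lambda>b. g * b) ` borel_subgroup n"

definition flag_variety :: "nat \<Rightarrow> complex mat set set" where
  "flag_variety n = coset n ` GL n"

inductive_set poly_fun :: "nat \<Rightarrow> (complex mat \<Rightarrow> complex) set" for n :: nat where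
  const: "(\<lambda>_. c) \<in> poly_fun n"
| entry: "i < n \<Longrightarrow> j < n \<Longrightarrow> (\<lambda>g. g $$ (i, j)) \<in> poly_fun n"
| add: "p \<in> poly_fun n \<Longrightarrow> q \<in> poly_fun n \<Longrightarrow> (\<lambda>g. p g + q g) \<in> poly_fun n"
| mult: "p \<in> poly_fun n \<Longrightarrow> q \<in> poly_fun n \<Longrightarrow> (\<lambda>g. p g * q g) \<in> poly_fun n"

definition GL_topology :: "nat \<Rightarrow> complex mat topology" where
  "GL_topology n = topology_generated_by ((\<lambda>p. {g \<in> GL n. p g \<noteq> 0}) ` poly_fun n)"

text \<open>The Zariski topology of \<open>G/B\<close> is the quotient topology along \<open>G \<rightarrow> G/B\<close>.\<close>

definition flag_topology :: "nat \<Rightarrow> complex mat set topology" where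
  "flag_topology n = topology (\<lambda>U. U \<subseteq> flag_variety n \<and> openin (GL_topology n) {g \<in> GL n. coset n g \<in> U})"

lemma openin_flag_topology:
  "openin (flag_topology n) U \<longleftrightarrow>
     U \<subseteq> flag_variety n \<and> openin (GL_topology n) {g \<in> GL n. coset n g \<in> U}"
proof -
  let ?P = "\<lambda>U. U \<subseteq> flag_variety n \<and> openin (GL_topology n) {g \<in> GL n. coset n g \<in> U}"
  have int: "?P (S \<inter> T)" if "?P S" "?P T" for S T
  proof -
    have "{g \<in> GL n. coset n g \<in> S \<inter> T} = {g \<in> GL n. coset n g \<in> S} \<inter> {g \<in> GL n. coset n g \<in> T}"
      by auto
    then show ?thesis using that by (auto intro: openin_Int)
  qed
  have un: "?P (\<Union>K)" if "\<forall>S\<in>K. ?P S" for K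
  proof -
    have "{g \<in> GL n. coset n g \<in> \<Union>K} = \<Union>((\<lambda>S. {g \<in> GL n. coset n g \<in> S}) ` K)"
      by auto
    moreover have "openin (GL_topology n) \<dots>"
      using that by (intro openin_Union) auto
    ultimately show ?thesis using that by (metis (lifting) Sup_least)
  qed
  have "istopology ?P"
    unfolding istopology_def using int un by blast
  then show ?thesis
    unfolding flag_topology_def by (simp add: topology_inverse')
qed

text \<open>
  Regular functions on a locally closed subvariety \<open>Z\<close> of \<open>G/B\<close>: locally on \<open>Z\<close>, the pullback of
  \<open>f\<close> to \<open>G\<close> is a quotient of polynomials in the matrix entries.
\<close>

definition regular_on :: "nat \<Rightarrow> complex mat set set \<Rightarrow> (complex mat set \<Rightarrow> complex) \<Rightarrow> bool" where
  "regular_on n Z f \<longleftrightarrow>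
     (\<forall>x\<in>Z. \<exists>V p q. openin (subtopology (flag_topology n) Z) V \<and> x \<in> V \<and>
        p \<in> poly_fun n \<and> q \<in> poly_fun n \<and>
        (\<forall>z\<in>V. \<forall>g\<in>z. q g \<noteq> 0 \<and> f z = p g / q g))"


section \<open>Schubert varieties and generic torus orbits\<close>

definition schubert_variety :: "nat \<Rightarrow> (nat \<Rightarrow> nat) \<Rightarrow> complex mat set set" where
  "schubert_variety n w =
     flag_topology n closure_of ((\<lambda>b. coset n (b * perm_mat n w)) ` borel_subgroup n)"

definition act :: "complex mat \<Rightarrow> complex mat set \<Rightarrow> complex mat set" where
  "act t x = (\<lambda>g. t * g) ` x"

definition torus_orbit :: "nat \<Rightarrow> complex mat set \<Rightarrow> complex mat set set" where
  "torus_orbit n x = (\<lambda>t. act t x) ` torus n"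

definition generic_torus_orbit :: "nat \<Rightarrow> (nat \<Rightarrow> nat) \<Rightarrow> complex mat set set \<Rightarrow> bool" where
  "generic_torus_orbit n w \<O> \<longleftrightarrow>
     (\<exists>x\<in>flag_variety n. \<O> = torus_orbit n x) \<and> \<O> \<subseteq> schubert_variety n w \<and>
     {x \<in> schubert_variety n w. \<forall>t\<in>torus n. act t x = x} \<subseteq> flag_topology n closure_of \<O>"


section \<open>The fan of a torus orbit closure\<close>

definition one_param :: "nat \<Rightarrow> int vec \<Rightarrow> complex \<Rightarrow> complex mat" where
  "one_param n a z = mat n n (\<lambda>(i, j). if i = j then z powi (a $ i) else 0)"

definition torus_fixing :: "nat \<Rightarrow> complex mat set set \<Rightarrow> complex mat set" where
  "torus_fixing n Y = {t \<in> torus n. \<forall>x\<in>Y. act t x = x}"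

definition fixing_space :: "nat \<Rightarrow> complex mat set set \<Rightarrow> real vec set" where
  "fixing_space n Y =
     LinearCombinations.module.span class_ring (module_vec TYPE(real) n)
       (map_vec real_of_int ` {a \<in> carrier_vec n. \<forall>z. z \<noteq> 0 \<longrightarrow> one_param n a z \<in> torus_fixing n Y})"

text \<open>The projection \<open>a \<mapsto> a + F\<close>; elements of the quotient space are cosets.\<close>

definition quot_proj :: "real vec set \<Rightarrow> real vec \<Rightarrow> real vec set" where
  "quot_proj F a = (\<lambda>f. a + f) ` F"

definition torus_char :: "nat \<Rightarrow> int vec \<Rightarrow> complex mat \<Rightarrow> complex" where
  "torus_char n m t = (\<Prod>i<n. (t $$ (i, i)) powi (m $ i))"

definition orbit_closure :: "nat \<Rightarrow> complex mat set \<Rightarrow> complex mat set set" where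
  "orbit_closure n y = flag_topology n closure_of torus_orbit n y"

text \<open>
  Let \<open>Y\<close> be the closure of the orbit of \<open>y\<close>, a (normal) toric variety with open orbit
  \<open>T/Stab y \<cong> T y\<close> via \<open>t \<mapsto> t y\<close>. \<open>char_regular_at n y m x\<close> says that the character \<open>t \<mapsto> t\<^sup>m\<close>,
  viewed as a rational function on \<open>Y\<close>, is regular at \<open>x\<close>. This forces the character to be trivial
  on \<open>Stab y\<close>, and the choice of \<open>y\<close> in its orbit only scales the function.
\<close>

definition char_regular_at :: "nat \<Rightarrow> complex mat set \<Rightarrow> int vec \<Rightarrow> complex mat set \<Rightarrow> bool" where
  "char_regular_at n y m x \<longleftrightarrow>
     (\<exists>V h. openin (subtopology (flag_topology n) (orbit_closure n y)) V \<and> x \<in> V \<and> regular_on n V h \<and>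
        (\<forall>t\<in>torus n. act t y \<in> V \<longrightarrow> h (act t y) = torus_char n m t))"

text \<open>
  The cone \<open>\<sigma>\<close> that the orbit-cone correspondence assigns to the orbit of \<open>x\<close>. The affine chart
  \<open>U\<^sub>\<sigma>\<close> is the spectrum of the algebra spanned by the characters \<open>m\<close> in the dual cone of \<open>\<sigma>\<close>, and its
  closed orbit is the orbit of \<open>x\<close>. The domain of regularity of a character is open and
  torus-stable, so a character is regular on \<open>U\<^sub>\<sigma>\<close> iff it is regular at \<open>x\<close>. Hence \<open>\<sigma>\<close> is the dual of
  the cone generated by the characters regular at \<open>x\<close>.
\<close>

definition orbit_cone :: "nat \<Rightarrow> complex mat set \<Rightarrow> complex mat set \<Rightarrow> real vec set set" where
  "orbit_cone n y x = quot_proj (fixing_space n (orbit_closure n y)) `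
     {a \<in> carrier_vec n. \<forall>m\<in>carrier_vec n. char_regular_at n y m x \<longrightarrow>
        0 \<le> map_vec real_of_int m \<bullet> a}"

definition toric_fan :: "nat \<Rightarrow> complex mat set \<Rightarrow> real vec set set set" where
  "toric_fan n y = orbit_cone n y ` orbit_closure n y"

definition maximal_cones :: "real vec set set set \<Rightarrow> real vec set set set" where
  "maximal_cones \<Sigma> = {\<sigma> \<in> \<Sigma>. \<forall>\<tau>\<in>\<Sigma>. \<sigma> \<subseteq> \<tau> \<longrightarrow> \<tau> = \<sigma>}"

end

theory Submission
  imports Defs
begin

text \<open>
  Write a point of \<open>G/B\<close> as \<open>g B\<close> and let \<open>p\<^sub>I(g)\<close> be the minor of \<open>g\<close> with rows \<open>I\<close> and the
  first \<open>|I|\<close> columns. On \<open>X\<^sub>w\<close> the minor \<open>p\<^sub>I\<close> vanishes unless \<open>I \<le> w\<^bsup>(d)\<^esup>\<close>. Every set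
  \<open>I \<le> w\<^bsup>(d)\<^esup>\<close> that the argument needs is \<open>u\<^bsup>(d)\<^esup>\<close> for a fixed point \<open>u B\<close> of \<open>X\<^sub>w\<close>, so the
  corresponding minor does not vanish on a generic orbit.

  Call \<open>(k, i)\<close> admissible for \<open>u\<close> if \<open>i\<close> could replace \<open>u k\<close> in the greedy procedure, and let \<open>D\<^sub>u\<close>
  be the cone of all \<open>a\<close> with \<open>a\<^bsub>u(k)\<^esub> \<le> a\<^sub>i\<close> for all admissible \<open>(k, i)\<close>. Quotients of minors show
  that \<open>e\<^sub>i - e\<^bsub>u(k)\<^esub>\<close> is regular at \<open>u B\<close>, so the cone of \<open>u B\<close> is contained in \<open>D\<^sub>u\<close>.
  Conversely, for \<open>a\<close> in the interior of \<open>D\<^sub>u\<close> the curve \<open>s\<^sup>a y\<close> tends to \<open>u B\<close> as \<open>s \<rightarrow> 0\<close>, and a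
  regular character stays bounded along it. Finally \<open>D\<^sub>u\<close> is the union of the chambers \<open>C(v)\<close> with
  \<open>v' = u\<close>: sort the coordinates of \<open>a \<in> D\<^sub>u\<close>, breaking ties in the order of \<open>u\<close>.
\<close>

section \<open>Bruhat order and the greedy procedure\<close>

text \<open>If position \<open>k\<close> violated the order, then \<open>B\<close> would have at
  least \<open>Suc k\<close> elements below \<open>Suc (ys ! k)\<close>, whereas \<open>A\<close>
  has at most \<open>k\<close> there.\<close>

lemma tuple_leI_card:
  assumes fin: "finite A" "finite B" and card: "card A = card B"
    and le: "\<And>c. card {b \<in> B. b < c} \<le> card {a \<in> A. a < c}"
  shows "tuple_le A B"
proof -
  define xs ys where "xs = sorted_list_of_set A" and "ys = sorted_list_of_set B"
  have len: "length xs = length ys"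
    using card by (simp add: xs_def ys_def)
  have sets: "set xs = A" "set ys = B" "sorted xs" "sorted ys" "distinct xs" "distinct ys"
    using fin by (simp_all add: xs_def ys_def)
  have "xs ! k \<le> ys ! k" if k: "k < length xs" for k
  proof (rule ccontr)
    assume *: "\<not> xs ! k \<le> ys ! k"
    have "(!) ys ` {..k} \<subseteq> {b \<in> B. b < Suc (ys ! k)}"
      using sets k len by (auto simp: less_Suc_eq_le intro: sorted_nth_mono)
    then have "card ((!) ys ` {..k}) \<le> card {b \<in> B. b < Suc (ys ! k)}"
      using fin by (intro card_mono) auto
    moreover have "inj_on ((!) ys) {..k}"
      using sets k len by (auto simp: inj_on_def nth_eq_iff_index_eq)
    ultimately have "Suc k \<le> card {b \<in> B. b < Suc (ys ! k)}"
      by (simp add: card_image)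
    also have "\<dots> \<le> card {a \<in> A. a < Suc (ys ! k)}" by (rule le)
    also have "{a \<in> A. a < Suc (ys ! k)} \<subseteq> (!) xs ` {..<k}"
    proof
      fix a assume a: "a \<in> {a \<in> A. a < Suc (ys ! k)}"
      then obtain l where l: "l < length xs" "a = xs ! l"
        using sets by (auto simp: in_set_conv_nth)
      have "l < k"
      proof (rule ccontr)
        assume "\<not> l < k"
        then have "xs ! k \<le> xs ! l" using sets l by (intro sorted_nth_mono) auto
        with a l * show False by auto
      qed
      with l show "a \<in> (!) xs ` {..<k}" by auto
    qed
    then have "card {a \<in> A. a < Suc (ys ! k)} \<le> card ((!) xs ` {..<k})"
      by (intro card_mono) auto
    also have "\<dots> \<le> k" using card_image_le[of "{..<k}" "(!) xs"] by simp
    finally show False by simp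
  qed
  then show ?thesis
    using len by (simp add: tuple_le_def list_all2_conv_all_nth flip: xs_def ys_def)
qed

text \<open>Elements of equal rank are matched. The terms of a determinant expansion are bijections
  as well, so this form links the order to minors.\<close>

lemma tuple_le_imp_bij:
  assumes "finite A" "finite B" "tuple_le A B"
  shows "\<exists>\<phi>. bij_betw \<phi> A B \<and> (\<forall>x\<in>A. x \<le> \<phi> x)"
proof -
  define xs ys where "xs = sorted_list_of_set A" and "ys = sorted_list_of_set B"
  have le: "list_all2 (\<le>) xs ys" using assms by (simp add: tuple_le_def xs_def ys_def)
  have len: "length xs = length ys" using le by (rule list_all2_lengthD)
  have bx: "bij_betw ((!) xs) {..<length xs} A"
    by (rule bij_betw_nth) (use assms in \<open>auto simp: xs_def\<close>)
  have b_y: "bij_betw ((!) ys) {..<length xs} B"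
    by (rule bij_betw_nth) (use assms len in \<open>auto simp: ys_def\<close>)
  define \<phi> where "\<phi> = (!) ys \<circ> inv_into {..<length xs} ((!) xs)"
  have "bij_betw \<phi> A B"
    unfolding \<phi>_def using bij_betw_inv_into[OF bx] b_y by (rule bij_betw_trans)
  moreover have "x \<le> \<phi> x" if x: "x \<in> A" for x
  proof -
    obtain k where k: "k < length xs" "x = xs ! k"
      using bx x by (auto simp: bij_betw_def)
    then have "\<phi> x = ys ! k"
      using bx by (simp add: \<phi>_def bij_betw_def)
    with k le show ?thesis by (simp add: list_all2_conv_all_nth)
  qed
  ultimately show ?thesis by blast
qed

text \<open>The bijection may fail to be monotone: every \<open>b < c\<close> in \<open>B\<close> is
  the image of some \<open>a \<le> b\<close>, so counting the elements below \<open>c\<close>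
  suffices.\<close>

lemma tuple_leI_bij:
  assumes "finite A" "bij_betw \<phi> A B" "\<And>x. x \<in> A \<Longrightarrow> x \<le> \<phi> x"
  shows "tuple_le A B"
proof (rule tuple_leI_card)
  show "finite B" using assms bij_betw_finite by blast
  show "card A = card B" using assms(2) by (rule bij_betw_same_card)
  fix c
  have "{b \<in> B. b < c} \<subseteq> \<phi> ` {a \<in> A. a < c}"
    using assms by (fastforce simp: bij_betw_def)
  then show "card {b \<in> B. b < c} \<le> card {a \<in> A. a < c}"
    using assms(1) by (intro surj_card_le) auto
qed fact

lemma tuple_le_card_less:
  assumes fin: "finite A" "finite B" and "tuple_le A B"
  shows "card {b \<in> B. b < c} \<le> card {a \<in> A. a < c}"
proof -
  obtain \<phi> where \<phi>: "bij_betw \<phi> A B" "\<And>x. x \<in> A \<Longrightarrow> x \<le> \<phi> x"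
    using tuple_le_imp_bij[OF assms] by blast
  have "{b \<in> B. b < c} \<subseteq> \<phi> ` {a \<in> A. a < c}"
    using \<phi> by (fastforce simp: bij_betw_def)
  then show ?thesis
    using assms(1) by (intro surj_card_le) auto
qed

lemma tuple_le_refl: "finite A \<Longrightarrow> tuple_le A A"
  by (rule tuple_leI_bij[of _ id]) auto

lemma tuple_le_trans:
  assumes "tuple_le A B" "tuple_le B C"
  shows "tuple_le A C"
  using assms unfolding tuple_le_def by (rule list_all2_trans[rotated]) simp

lemma tuple_le_card_eq: "tuple_le A B \<Longrightarrow> card A = card B"
  unfolding tuple_le_def by (auto dest: list_all2_lengthD)

text \<open>Here \<open>x\<close> is the least number outside \<open>A\<close>. For
  \<open>c \<le> x\<close> all numbers below \<open>c\<close> lie in \<open>A\<close>, which is the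
  largest count possible; for \<open>c > x\<close> the count for \<open>A\<close> rises by one and
  the count for \<open>B\<close> by at most one.\<close>

lemma tuple_le_insert_least:
  assumes le: "tuple_le A B" and fin: "finite A" "finite B"
    and z: "z \<notin> B" and x: "x \<notin> A" "{..<x} \<subseteq> A"
  shows "tuple_le (insert x A) (insert z B)"
proof (rule tuple_leI_card)
  show "card (insert x A) = card (insert z B)"
    using le fin x z by (simp add: tuple_le_card_eq)
  fix c
  show "card {b \<in> insert z B. b < c} \<le> card {a \<in> insert x A. a < c}"
  proof (cases "x < c")
    case True
    have "card {b \<in> insert z B. b < c} \<le> card (insert z {b \<in> B. b < c})"
      using fin by (intro card_mono) auto
    also have "\<dots> = Suc (card {b \<in> B. b < c})" using fin z by simp
    also have "\<dots> \<le> Suc (card {a \<in> A. a < c})"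
      using tuple_le_card_less[OF fin le] by simp
    also have "\<dots> = card (insert x {a \<in> A. a < c})" using fin x by simp
    also have "insert x {a \<in> A. a < c} = {a \<in> insert x A. a < c}" using True by auto
    finally show ?thesis .
  next
    case False
    then have "c \<le> x" by simp
    then have "{..<c} \<subseteq> A" using x(2) by (meson lessThan_subset_iff order_trans)
    then have "{a \<in> insert x A. a < c} = {..<c}" by auto
    moreover have "card {b \<in> insert z B. b < c} \<le> card {..<c}" by (intro card_mono) auto
    ultimately show ?thesis by simp
  qed
qed (use fin in auto)

section \<open>The tableau criterion and the Bruhat order\<close>

text \<open>The tableau criterion for the Bruhat order. It is derived from \<open>bruhat_le\<close>
  below, and the geometric arguments work with this form.\<close>

definition tableau_le :: "nat \<Rightarrow> (nat \<Rightarrow> nat) \<Rightarrow> (nat \<Rightarrow> nat) \<Rightarrow> bool" where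
  "tableau_le n u w \<longleftrightarrow> (\<forall>k\<le>n. tuple_le (u ` {..<k}) (w ` {..<k}))"

lemma permutes_transpose_comp:
  assumes "u permutes {..<n}" "i < n" "j < n"
  shows "u \<circ> Transposition.transpose i j permutes {..<n}"
  using assms by (intro permutes_compose permutes_swap_id) auto

text \<open>There is an injection from the inversions after the swap into those of \<open>u\<close>:
  swap the two positions of a pair if they stay in order, and otherwise leave the pair
  alone.\<close>

lemma perm_length_transpose_le:
  assumes ij: "i < j" "j < n" and gt: "u j < u i"
  shows "perm_length n (u \<circ> Transposition.transpose i j) \<le> perm_length n u"
proof -
  define \<tau> where "\<tau> = Transposition.transpose i j"
  let ?inv = "\<lambda>v. {(a, b). a < b \<and> b < n \<and> v b < v a}"
  define \<phi> where "\<phi> p = (if \<tau> (fst p) < \<tau> (snd p) then (\<tau> (fst p), \<tau> (snd p)) else p)"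
    for p :: "nat \<times> nat"
  have \<tau>\<tau>: "\<tau> (\<tau> x) = x" for x by (simp add: \<tau>_def)
  have \<tau>n: "\<tau> x < n" if "x < n" for x
    using that ij by (auto simp: \<tau>_def Transposition.transpose_def)
  have fin: "finite (?inv u)" by (rule finite_subset[of _ "{..<n} \<times> {..<n}"]) auto
  have "\<phi> p \<in> ?inv u" if p: "p \<in> ?inv (u \<circ> \<tau>)" for p
  proof -
    obtain a b where ab: "p = (a, b)" "a < b" "b < n" "u (\<tau> b) < u (\<tau> a)"
      using p by auto
    show ?thesis
    proof (cases "\<tau> a < \<tau> b")
      case True
      with ab \<tau>n show ?thesis by (simp add: \<phi>_def)
    next
      case False
      \<comment> \<open>The swap reverses the pair only if \<open>a = i\<close> and
        \<open>b \<le> j\<close>, or \<open>b = j\<close> and \<open>i \<le> a\<close>. In each case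
        \<open>u j < u i\<close> gives the claim or rules the pair out.\<close>
      have "u b < u a"
        using False ab gt ij
        by (cases "a = i"; cases "a = j"; cases "b = i"; cases "b = j")
          (simp_all add: \<tau>_def Transposition.transpose_def)
      with False ab show ?thesis by (simp add: \<phi>_def)
    qed
  qed
  moreover have "inj_on \<phi> (?inv (u \<circ> \<tau>))"
  proof (rule inj_onI)
    fix p q assume pq: "p \<in> ?inv (u \<circ> \<tau>)" "q \<in> ?inv (u \<circ> \<tau>)" "\<phi> p = \<phi> q"
    obtain a b c d where abcd: "p = (a, b)" "q = (c, d)" by fastforce
    have "a < b" "c < d" using pq abcd by auto
    have inj: "\<tau> x = \<tau> y \<longleftrightarrow> x = y" for x y by (metis \<tau>\<tau>)
    show "p = q"
    proof (cases "\<tau> a < \<tau> b"; cases "\<tau> c < \<tau> d")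
      assume "\<tau> a < \<tau> b" "\<tau> c < \<tau> d"
      with pq(3) abcd show ?thesis by (simp add: \<phi>_def inj)
    next
      assume "\<tau> a < \<tau> b" and n: "\<not> \<tau> c < \<tau> d"
      with pq(3) abcd have "c = \<tau> a" "d = \<tau> b" by (simp_all add: \<phi>_def)
      with n \<open>a < b\<close> show ?thesis by (simp add: \<tau>\<tau>)
    next
      assume n: "\<not> \<tau> a < \<tau> b" and "\<tau> c < \<tau> d"
      with pq(3) abcd have "a = \<tau> c" "b = \<tau> d" by (simp_all add: \<phi>_def)
      with n \<open>c < d\<close> show ?thesis by (simp add: \<tau>\<tau>)
    next
      assume "\<not> \<tau> a < \<tau> b" "\<not> \<tau> c < \<tau> d"
      with pq(3) abcd show ?thesis by (simp add: \<phi>_def)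
    qed
  qed
  ultimately show ?thesis
    unfolding perm_length_def \<tau>_def[symmetric] using card_inj_on_le[of \<phi> _ "?inv u"] fin
    by (meson image_subsetI)
qed

text \<open>Growth of the length forces \<open>u i < u j\<close>. The swap changes the set of the
  first \<open>k\<close> values only if \<open>i < k \<le> j\<close>, and then it replaces
  \<open>u i\<close> by the larger \<open>u j\<close>.\<close>

lemma bruhat_step_tableau_le:
  assumes u: "u permutes {..<n}" and step: "bruhat_step n u v"
  shows "tableau_le n u v"
  unfolding tableau_le_def
proof (intro allI impI)
  fix k assume "k \<le> n"
  obtain i j where ij: "i < j" "j < n" and v: "v = u \<circ> Transposition.transpose i j"
    and len: "perm_length n u < perm_length n v"
    using step by (auto simp: bruhat_step_def)
  have inj: "inj u" using u by (rule permutes_inj)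
  have lt: "u i < u j"
    using perm_length_transpose_le[OF ij, of u] len ij injD[OF inj, of i j] v
    by (cases "u i" "u j" rule: linorder_cases) auto
  show "tuple_le (u ` {..<k}) (v ` {..<k})"
  proof (cases "i < k \<and> k \<le> j")
    case True
    have "Transposition.transpose i j ` {..<k} = insert j ({..<k} - {i})"
    proof (intro equalityI subsetI)
      fix x assume "x \<in> insert j ({..<k} - {i})"
      with True show "x \<in> Transposition.transpose i j ` {..<k}"
        by (intro image_eqI[of _ _ "Transposition.transpose i j x"])
          (auto simp: Transposition.transpose_def)
    qed (use True in \<open>auto simp: Transposition.transpose_def split: if_splits\<close>)
    then have "v ` {..<k} = insert (u j) (u ` ({..<k} - {i}))"
      unfolding v image_comp[symmetric] by simp
    moreover have "u ` {..<k} = insert (u i) (u ` ({..<k} - {i}))"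
      using True by auto
    moreover have "bij_betw (\<lambda>x. if x = u i then u j else x)
        (insert (u i) (u ` ({..<k} - {i}))) (insert (u j) (u ` ({..<k} - {i})))"
    proof (rule bij_betw_imageI)
      show "inj_on (\<lambda>x. if x = u i then u j else x) (insert (u i) (u ` ({..<k} - {i})))"
        using True by (auto intro!: inj_onI simp: inj_eq[OF inj] split: if_splits)
      have "(\<lambda>x. if x = u i then u j else x) ` (u ` ({..<k} - {i})) = u ` ({..<k} - {i})"
        unfolding image_image by (rule image_cong) (auto simp: inj_eq[OF inj])
      then show "(\<lambda>x. if x = u i then u j else x) ` insert (u i) (u ` ({..<k} - {i}))
          = insert (u j) (u ` ({..<k} - {i}))" by (simp only: image_insert refl if_True)
    qed
    ultimately show ?thesis
      using lt by (intro tuple_leI_bij[of _ "\<lambda>x. if x = u i then u j else x"]) auto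
  next
    case False
    have "Transposition.transpose i j ` {..<k} = {..<k}"
    proof (intro equalityI subsetI)
      fix x assume "x \<in> {..<k}"
      with False ij show "x \<in> Transposition.transpose i j ` {..<k}"
        by (intro image_eqI[of _ _ "Transposition.transpose i j x"])
          (auto simp: Transposition.transpose_def)
    qed (use False ij in \<open>auto simp: Transposition.transpose_def split: if_splits\<close>)
    then have "v ` {..<k} = u ` {..<k}" unfolding v image_comp[symmetric] by simp
    then show ?thesis by (simp add: tuple_le_refl)
  qed
qed

lemma bruhat_le_tableau_le:
  assumes "bruhat_le n u w" "u permutes {..<n}"
  shows "tableau_le n u w"
  using assms(1) unfolding bruhat_le_def
proof (induction rule: rtranclp_induct)
  case base
  show ?case by (simp add: tableau_le_def tuple_le_refl)
next
  case (step v w)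
  have "v permutes {..<n}"
    using step(1)
  proof (induction rule: rtranclp_induct)
    case base
    show ?case by (rule assms)
  next
    case (step v w)
    then show ?case by (auto simp: bruhat_step_def intro: permutes_transpose_comp)
  qed
  then have "tableau_le n v w" using step(2) by (rule bruhat_step_tableau_le)
  with step.IH show ?case unfolding tableau_le_def by (blast intro: tuple_le_trans)
qed

abbreviation perm_inv :: "(nat \<Rightarrow> nat) \<Rightarrow> nat \<Rightarrow> nat" where
  "perm_inv \<equiv> Hilbert_Choice.inv"

section \<open>Admissible pairs and completion of partial permutations\<close>

definition admissible :: "nat \<Rightarrow> (nat \<Rightarrow> nat) \<Rightarrow> (nat \<Rightarrow> nat) \<Rightarrow> nat \<Rightarrow> nat \<Rightarrow> bool" where
  "admissible n w u k i \<longleftrightarrow>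
     k < n \<and> i < n \<and> i \<notin> u ` {..<k} \<and> tuple_le (insert i (u ` {..<k})) (w ` {..<Suc k})"

definition fixed_point_cone :: "nat \<Rightarrow> (nat \<Rightarrow> nat) \<Rightarrow> (nat \<Rightarrow> nat) \<Rightarrow> real vec set" where
  "fixed_point_cone n w u = {a \<in> carrier_vec n. \<forall>k i. admissible n w u k i \<longrightarrow> a $ u k \<le> a $ i}"

lemma permutes_lessThan_iff: "u permutes {..<n} \<Longrightarrow> u i < n \<longleftrightarrow> i < (n::nat)"
  using permutes_in_image[of u "{..<n}" i] by simp

lemma permutes_lessThan_inv_iff: "u permutes {..<n} \<Longrightarrow> perm_inv u i < n \<longleftrightarrow> i < (n::nat)"
  by (rule permutes_lessThan_iff[OF permutes_inv])

lemma lessThan_Suc_image: "u ` {..<Suc k} = insert (u k) (u ` {..<k})"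
  by (auto simp: lessThan_Suc)

lemma permutes_mem_image_iff:
  assumes "u permutes S"
  shows "i \<in> u ` A \<longleftrightarrow> perm_inv u i \<in> A"
proof
  assume "i \<in> u ` A"
  then show "perm_inv u i \<in> A" by (auto simp: permutes_inverses(2)[OF assms])
next
  assume "perm_inv u i \<in> A"
  then have "u (perm_inv u i) \<in> u ` A" by (rule imageI)
  then show "i \<in> u ` A" by (simp add: permutes_inverses(1)[OF assms])
qed

lemma permutes_notin_image_lessThan:
  assumes "u permutes {..<n}"
  shows "i \<notin> u ` {..<k} \<longleftrightarrow> k \<le> perm_inv u i"
  using permutes_mem_image_iff[OF assms, of i] by (simp add: not_less)

lemma admissible_self:
  assumes "u permutes {..<n}" "tableau_le n u w" "k < n"
  shows "admissible n w u k (u k)"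
proof -
  have "tuple_le (u ` {..<Suc k}) (w ` {..<Suc k})"
    using assms unfolding tableau_le_def by (meson Suc_leI)
  then show ?thesis
    using assms unfolding lessThan_Suc_image[of u]
    by (simp add: admissible_def permutes_lessThan_iff permutes_notin_image_lessThan
      permutes_inverses)
qed

lemma tableau_le_extend:
  assumes "w permutes {..<n}" "k \<le> n" "inj_on f {..<k}" "f ` {..<k} \<subseteq> {..<n}"
    and "\<And>j. j \<le> k \<Longrightarrow> tuple_le (f ` {..<j}) (w ` {..<j})"
  shows "\<exists>u. u permutes {..<n} \<and> tableau_le n u w \<and> (\<forall>j<k. u j = f j)"
  using assms(2-)
proof (induction "n - k" arbitrary: k f)
  case 0
  then have k: "k = n" by simp
  define u where "u j = (if j < n then f j else j)" for j
  have img: "u ` {..<j} = f ` {..<j}" if "j \<le> n" for j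
    using that by (intro image_cong) (auto simp: u_def)
  have "inj_on u {..<n}" using 0 k by (auto simp: inj_on_def u_def)
  moreover have "u ` {..<n} \<subseteq> {..<n}" using 0 k img[of n] by simp
  ultimately have "bij_betw u {..<n} {..<n}"
    by (simp add: bij_betw_def endo_inj_surj)
  then have "u permutes {..<n}" by (rule bij_imp_permutes) (simp add: u_def)
  moreover have "tableau_le n u w" using 0 k img by (simp add: tableau_le_def)
  ultimately show ?case using k by (auto simp: u_def)
next
  case (Suc d)
  then have k: "k < n" by simp
  \<comment> \<open>This value is below \<open>n\<close>, since the \<open>k < n\<close> values used
    so far cannot exhaust \<open>{..<n}\<close>.\<close>
  define x where "x = (LEAST x. x \<notin> f ` {..<k})"
  have "card (f ` {..<k}) < card {..<n}" using card_image_le[of "{..<k}" f] k by simp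
  then obtain y where y: "y < n" "y \<notin> f ` {..<k}"
    by (metis card_mono finite_imageI finite_lessThan lessThan_iff not_le subsetI)
  have x: "x \<notin> f ` {..<k}" unfolding x_def by (rule LeastI[of _ y]) (rule y)
  have xy: "x \<le> y" unfolding x_def by (rule Least_le) (rule y)
  have below: "{..<x} \<subseteq> f ` {..<k}" unfolding x_def by (auto dest: not_less_Least)
  have img: "(f(k := x)) ` {..<j} = f ` {..<j}" if "j \<le> k" for j
    using that by (intro image_cong) auto
  have img': "(f(k := x)) ` {..<Suc k} = insert x (f ` {..<k})"
    unfolding lessThan_Suc_image img[OF order_refl] by simp
  have wk: "w k \<notin> w ` {..<k}"
    using permutes_inj[OF assms(1)] by (auto dest: injD)
  have "\<exists>u. u permutes {..<n} \<and> tableau_le n u w \<and> (\<forall>j<Suc k. u j = (f(k := x)) j)"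
  proof (rule Suc.hyps(1))
    show "d = n - Suc k" using Suc.hyps(2) by simp
    show "Suc k \<le> n" using k by simp
    show "inj_on (f(k := x)) {..<Suc k}"
      using Suc.prems(2) x by (auto simp: inj_on_def lessThan_Suc)
    show "(f(k := x)) ` {..<Suc k} \<subseteq> {..<n}"
      using img' Suc.prems(3) xy y by simp
    fix j assume "j \<le> Suc k"
    then consider "j \<le> k" | "j = Suc k" by linarith
    then show "tuple_le ((f(k := x)) ` {..<j}) (w ` {..<j})"
    proof cases
      case 1
      with Suc.prems(4) show ?thesis by (simp add: img)
    next
      case 2
      have "tuple_le (insert x (f ` {..<k})) (insert (w k) (w ` {..<k}))"
        by (rule tuple_le_insert_least) (use Suc.prems(4) x below wk in auto)
      with 2 show ?thesis using img' by (simp add: lessThan_Suc_image)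
    qed
  qed
  then show ?case by (metis fun_upd_other less_SucI less_irrefl)
qed

text \<open>Every admissible pair is visible at some fixed point: the prefix
  \<open>u 0, ..., u (k - 1), i\<close> starts a permutation below \<open>w\<close>. This is how
  admissible pairs yield nonvanishing minors.\<close>

lemma admissible_extend:
  assumes "w permutes {..<n}" "u permutes {..<n}" "tableau_le n u w" "admissible n w u k i"
  shows "\<exists>u'. u' permutes {..<n} \<and> tableau_le n u' w \<and> (\<forall>j\<le>k. u' j = (u(k := i)) j)"
proof -
  have img: "(u(k := i)) ` {..<j} = u ` {..<j}" if "j \<le> k" for j
    using that by (intro image_cong) auto
  have img': "(u(k := i)) ` {..<Suc k} = insert i (u ` {..<k})"
    unfolding lessThan_Suc_image img[OF order_refl] by simp
  have "\<exists>u'. u' permutes {..<n} \<and> tableau_le n u' w \<and> (\<forall>j<Suc k. u' j = (u(k := i)) j)"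
  proof (rule tableau_le_extend)
    show "Suc k \<le> n" using assms(4) by (simp add: admissible_def)
    have "inj_on u {..<k}" using permutes_inj[OF assms(2)] by (rule inj_on_subset) simp
    then have "inj_on (u(k := i)) {..<k}" by (rule inj_on_cong[THEN iffD1, rotated]) simp
    moreover have "i \<notin> (u(k := i)) ` {..<k}"
      unfolding img[OF order_refl] using assms(4) by (simp add: admissible_def)
    ultimately show "inj_on (u(k := i)) {..<Suc k}"
      unfolding lessThan_Suc inj_on_insert by simp
    show "(u(k := i)) ` {..<Suc k} \<subseteq> {..<n}"
      using img' assms(4) permutes_lessThan_iff[OF assms(2)] by (auto simp: admissible_def)
    fix j assume "j \<le> Suc k"
    then consider "j \<le> k" | "j = Suc k" by linarith
    then show "tuple_le ((u(k := i)) ` {..<j}) (w ` {..<j})"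
    proof cases
      case 1
      with assms show ?thesis by (simp add: img admissible_def tableau_le_def)
    next
      case 2
      with img' assms(4) show ?thesis by (simp add: admissible_def)
    qed
  qed fact
  then show ?thesis by (simp add: less_Suc_eq_le)
qed

section \<open>When the greedy procedure returns a given permutation\<close>

text \<open>While the values selected so far are \<open>u 0, ..., u (k - 1)\<close>, the candidates
  for the next index are the positions in \<open>v\<close> of the admissible values.\<close>

lemma greedy_indices_step:
  assumes u: "u permutes {..<n}" and v: "v permutes {..<n}" and k: "k < n"
    and ind: "greedy_indices n w v k = map (perm_inv v \<circ> u) [0..<k]"
  shows "greedy_indices n w v (Suc k)
       = map (perm_inv v \<circ> u) [0..<k] @ [Min {i. admissible n w u k (v i)}]"
proof -
  have set: "set (greedy_indices n w v k) = perm_inv v ` u ` {..<k}"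
    unfolding ind by (auto simp: image_comp)
  have vset: "v ` perm_inv v ` u ` {..<k} = u ` {..<k}"
    using v by (simp add: image_image permutes_inverses)
  have mem: "i \<in> perm_inv v ` u ` {..<k} \<longleftrightarrow> v i \<in> u ` {..<k}" for i
    using permutes_mem_image_iff[OF permutes_inv[OF v], of i] by (simp add: permutes_inv_inv[OF v])
  have "{i \<in> {..<n} - perm_inv v ` u ` {..<k}.
      tuple_le (insert (v i) (u ` {..<k})) (w ` {..<Suc k})} = {i. admissible n w u k (v i)}"
    using k v by (auto simp: admissible_def mem permutes_lessThan_iff)
  then show ?thesis unfolding greedy_indices.simps Let_def set vset by (simp only: ind)
qed

lemma length_greedy_indices: "length (greedy_indices n w v k) = k"
  by (induction k) (simp_all add: Let_def)

lemma greedy_indices_nth_mono: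
  assumes "j < k" "k \<le> m"
  shows "greedy_indices n w v m ! j = greedy_indices n w v k ! j"
  using assms(2,1)
    by (induction rule: dec_induct) (simp_all add: Let_def nth_append length_greedy_indices)

text \<open>The procedure picks \<open>u k\<close> at step \<open>k\<close> exactly if no admissible
  value stands further left in \<open>v\<close>. Since \<open>u k\<close> is itself admissible, the
  minimum is taken over a nonempty finite set, and induction on \<open>k\<close> gives both
  directions.\<close>

lemma greedy_perm_eq_iff:
  assumes u: "u permutes {..<n}" and v: "v permutes {..<n}"
    and le: "tableau_le n u w"
  shows "greedy_perm n w v = u \<longleftrightarrow> (\<forall>k<n. \<forall>i. admissible n w u k (v i) \<longrightarrow> perm_inv v (u k) \<le> i)"
proof -
  have fin: "finite {i. admissible n w u k (v i)}" for k
    by (rule finite_subset[of _ "{..<n}"]) (use v in \<open>auto simp: admissible_def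
      permutes_lessThan_iff\<close>)
  have self: "admissible n w u k (v (perm_inv v (u k)))" if "k < n" for k
    using admissible_self[OF u le that] v by (simp add: permutes_inverses)
  show ?thesis
  proof
    assume eq: "greedy_perm n w v = u"
    have *: "greedy_indices n w v k = map (perm_inv v \<circ> u) [0..<k]" if "k \<le> n" for k
      using that
    proof (induction k)
      case (Suc k)
      then have k: "k < n" and IH: "greedy_indices n w v k = map (perm_inv v \<circ> u) [0..<k]"
        by simp_all
      let ?m = "Min {i. admissible n w u k (v i)}"
      \<comment> \<open>The entry at index \<open>k\<close> is settled in step \<open>Suc k\<close>,
        so it can be compared with the minimum taken there.\<close>
      have "greedy_indices n w v n ! k = greedy_indices n w v (Suc k) ! k"
        by (rule greedy_indices_nth_mono) (use k in auto)
      also have "\<dots> = ?m" using greedy_indices_step[OF u v k IH] by (simp add: nth_append)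
      finally have "v ?m = u k" using eq k by (auto simp: greedy_perm_def)
      then have "?m = perm_inv v (u k)" using v by (metis permutes_inverses(2))
      then show ?case using greedy_indices_step[OF u v k IH] by simp
    qed simp
    show "\<forall>k<n. \<forall>i. admissible n w u k (v i) \<longrightarrow> perm_inv v (u k) \<le> i"
    proof (intro allI impI)
      fix k i assume k: "k < n" and adm: "admissible n w u k (v i)"
      have "map (perm_inv v \<circ> u) [0..<Suc k] = map (perm_inv v \<circ> u) [0..<k] @ [Min {i. admissible
        n w u k (v i)}]"
        using greedy_indices_step[OF u v k] *[of k] *[of "Suc k"] k by simp
      then have "perm_inv v (u k) = Min {i. admissible n w u k (v i)}" by simp
      with adm fin show "perm_inv v (u k) \<le> i" by simp
    qed
  next
    assume min: "\<forall>k<n. \<forall>i. admissible n w u k (v i) \<longrightarrow> perm_inv v (u k) \<le> i"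
    have "greedy_indices n w v k = map (perm_inv v \<circ> u) [0..<k]" if "k \<le> n" for k
      using that
    proof (induction k)
      case (Suc k)
      then have k: "k < n" and IH: "greedy_indices n w v k = map (perm_inv v \<circ> u) [0..<k]"
        by simp_all
      have "Min {i. admissible n w u k (v i)} = perm_inv v (u k)"
        by (rule Min_eqI) (use fin min self k in auto)
      with greedy_indices_step[OF u v k IH] show ?case by simp
    qed simp
    then have "greedy_indices n w v n = map (perm_inv v \<circ> u) [0..<n]" by simp
    then show "greedy_perm n w v = u"
      by (auto simp: greedy_perm_def fun_eq_iff permutes_inverses(1)[OF v] permutes_not_in[OF u])
  qed
qed

section \<open>Fixed-point cones as unions of Weyl chambers\<close>

text \<open>The rank \<open>r x\<close>, the number of elements below \<open>x\<close>, is strictly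
  monotone and less than \<open>n\<close>, hence a permutation. The sorted one-line notation is its
  inverse.\<close>

lemma exists_sorting_permutation:
  fixes R :: "nat \<Rightarrow> nat \<Rightarrow> bool"
  assumes irrefl: "\<And>x. \<not> R x x" and trans: "\<And>x y z. R x y \<Longrightarrow> R y z \<Longrightarrow> R x z"
    and total: "\<And>x y. x < n \<Longrightarrow> y < n \<Longrightarrow> x \<noteq> y \<Longrightarrow> R x y \<or> R y x"
  shows "\<exists>v. v permutes {..<n} \<and> (\<forall>x<n. \<forall>y<n. R x y \<longrightarrow> perm_inv v x < perm_inv v y)"
proof -
  define r where "r x = (if x < n then card {y. y < n \<and> R y x} else x)" for x
  have mono: "r x < r y" if "x < n" "y < n" "R x y" for x y
  proof -
    have "{z. z < n \<and> R z x} \<subset> {z. z < n \<and> R z y}" using that irrefl trans by blast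
    then have "card {z. z < n \<and> R z x} < card {z. z < n \<and> R z y}" by (intro psubset_card_mono) auto
    with that show ?thesis by (simp add: r_def)
  qed
  have "r x < n" if "x < n" for x
  proof -
    have "{z. z < n \<and> R z x} \<subset> {..<n}" using that irrefl by blast
    then have "card {z. z < n \<and> R z x} < card {..<n}" by (intro psubset_card_mono) auto
    with that show ?thesis by (simp add: r_def)
  qed
  moreover have "inj_on r {..<n}"
  proof (rule inj_onI)
    fix x y assume "x \<in> {..<n}" "y \<in> {..<n}" "r x = r y"
    then show "x = y" using total[of x y] mono[of x y] mono[of y x] by auto
  qed
  ultimately have "bij_betw r {..<n} {..<n}"
    by (intro bij_betw_imageI endo_inj_surj) auto
  then have "r permutes {..<n}" by (rule bij_imp_permutes) (simp add: r_def)
  then show ?thesis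
    using mono by (intro exI[of _ "perm_inv r"]) (auto simp: permutes_inv permutes_inv_inv)
qed

text \<open>By \<open>greedy_perm_eq_iff\<close>, \<open>v' = u\<close> means that
  \<open>u k\<close> stands weakly to the left of every admissible \<open>i\<close> in
  \<open>v\<close>. On the chamber of \<open>v\<close> this order of positions becomes the
  inequalities of the cone; conversely a point of the cone determines such a \<open>v\<close> by
  sorting.\<close>

lemma fixed_point_cone_eq_UN_chambers:
  assumes u: "u permutes {..<n}" and le: "tableau_le n u w"
  shows "fixed_point_cone n w u = (\<Union>v\<in>{v. v permutes {..<n} \<and> greedy_perm n w v =
    u}. weyl_chamber n v)"
proof (intro equalityI subsetI)
  fix a assume "a \<in> (\<Union>v\<in>{v. v permutes {..<n} \<and> greedy_perm n w v = u}. weyl_chamber n v)"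
  then obtain v where v: "v permutes {..<n}" "greedy_perm n w v = u" and a: "a \<in> weyl_chamber n v"
    by auto
  have "a $ u k \<le> a $ i" if adm: "admissible n w u k i" for k i
  proof -
    have kn: "k < n" "i < n" using adm by (auto simp: admissible_def)
    have "perm_inv v (u k) \<le> perm_inv v i"
      using v(2) adm kn unfolding greedy_perm_eq_iff[OF u v(1) le]
        by (simp add: permutes_inverses[OF v(1)])
    moreover have "perm_inv v i < n" using kn v by (simp add: permutes_lessThan_inv_iff)
    ultimately have "a $ v (perm_inv v (u k)) \<le> a $ v (perm_inv v i)"
      using a unfolding weyl_chamber_def by blast
    then show ?thesis by (simp add: permutes_inverses[OF v(1)])
  qed
  with a show "a \<in> fixed_point_cone n w u" by (simp add: fixed_point_cone_def weyl_chamber_def)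
next
  fix a assume a: "a \<in> fixed_point_cone n w u"
  text \<open>Sort by \<open>a\<close>, breaking ties in the order \<open>u 0, u 1, \<dots>\<close>.\<close>
  define R where "R x y \<longleftrightarrow> a $ x < a $ y \<or> a $ x = a $ y \<and> perm_inv u x < perm_inv u y" for x y
  have inj: "perm_inv u x = perm_inv u y \<longleftrightarrow> x = y" for x y using u by (metis permutes_inverses(1))
  obtain v where v: "v permutes {..<n}" and sorted: "\<And>x y. x < n \<Longrightarrow> y < n \<Longrightarrow> R x y \<Longrightarrow>
    perm_inv v x < perm_inv v y"
  proof -
    have "\<exists>v. v permutes {..<n} \<and> (\<forall>x<n. \<forall>y<n. R x y \<longrightarrow> perm_inv v x < perm_inv v y)"
    proof (rule exists_sorting_permutation)
      fix x y :: nat assume "x \<noteq> y"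
      then show "R x y \<or> R y x"
        unfolding R_def using inj[of x y] by linarith
    qed (auto simp: R_def)
    then show thesis using that by blast
  qed
  have "a $ v i \<le> a $ v j" if "i \<le> j" "j < n" for i j
  proof (rule ccontr)
    assume "\<not> a $ v i \<le> a $ v j"
    then have "perm_inv v (v j) < perm_inv v (v i)"
      using that v by (intro sorted) (auto simp: R_def permutes_lessThan_iff)
    with that show False by (simp add: permutes_inverses[OF v])
  qed
  moreover have "greedy_perm n w v = u"
    unfolding greedy_perm_eq_iff[OF u v le]
  proof (intro allI impI)
    fix k i assume k: "k < n" and adm: "admissible n w u k (v i)"
    have le_a: "a $ u k \<le> a $ v i" using a adm by (simp add: fixed_point_cone_def)
    \<comment> \<open>An admissible value is none of \<open>u 0, ..., u (k - 1)\<close>, so ties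
      with \<open>u k\<close> are broken in favour of \<open>u k\<close>.\<close>
    have "k \<le> perm_inv u (v i)"
      using adm permutes_notin_image_lessThan[OF u] by (simp add: admissible_def)
    show "perm_inv v (u k) \<le> i"
    proof (cases "v i = u k")
      case True
      then show ?thesis by (metis order.refl permutes_inverses(2) v)
    next
      case False
      then have "perm_inv u (v i) \<noteq> k" using u by (metis permutes_inverses(1))
      with \<open>k \<le> perm_inv u (v i)\<close> le_a have "R (u k) (v i)"
        by (auto simp: R_def permutes_inverses[OF u])
      then have "perm_inv v (u k) < perm_inv v (v i)"
        using adm k u by (intro sorted) (auto simp: permutes_lessThan_iff admissible_def)
      then show ?thesis by (simp add: permutes_inverses[OF v])
    qed
  qed
  ultimately show "a \<in> (\<Union>v\<in>{v. v permutes {..<n} \<and> greedy_perm n w v = u}. weyl_chamber n v)"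
    using a v by (auto simp: weyl_chamber_def fixed_point_cone_def)
qed

text \<open>The vector \<open>perm_inv u\<close> lies in the interior of the chamber of \<open>u\<close>.\<close>

lemma inv_vec_in_fixed_point_cone:
  assumes u: "u permutes {..<n}"
  shows "vec n (\<lambda>i. real (perm_inv u i)) \<in> fixed_point_cone n w u"
proof -
  have "vec n (\<lambda>i. real (perm_inv u i)) $ u k \<le> vec n (\<lambda>i. real (perm_inv u i)) $ i"
    if "admissible n w u k i" for k i
  proof -
    have "k < n" "i < n" "k \<le> perm_inv u i"
      using that unfolding admissible_def permutes_notin_image_lessThan[OF u] by blast+
    then show ?thesis by (simp add: permutes_lessThan_iff[OF u] permutes_inverses(2)[OF u])
  qed
  then show ?thesis by (simp add: fixed_point_cone_def)
qed

text \<open>This separates the cones of different fixed points, as maximality requires. If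
  \<open>u'\<close> and \<open>u\<close> agree below \<open>k\<close>, they have the same admissible
  values at \<open>k\<close>. So \<open>u k\<close> is admissible for \<open>u'\<close>, which puts
  \<open>u' k\<close> at position at most \<open>k\<close> in \<open>u\<close>; smaller positions
  are taken.\<close>

lemma inv_vec_in_fixed_point_cone_imp_eq:
  assumes u: "u permutes {..<n}" and u': "u' permutes {..<n}"
    and le: "tableau_le n u w" "tableau_le n u' w"
    and mem: "vec n (\<lambda>i. real (perm_inv u i)) \<in> fixed_point_cone n w u'"
  shows "u' = u"
proof -
  have *: "u' k = u k" if "k < n" for k
    using that
  proof (induction k rule: less_induct)
    case (less k)
    then have img: "u' ` {..<k} = u ` {..<k}" by (intro image_cong) auto
    have adm: "admissible n w u' k i \<longleftrightarrow> admissible n w u k i" for i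
      by (simp add: admissible_def img)
    have "admissible n w u' k (u k)"
      using admissible_self[OF u le(1) \<open>k < n\<close>] by (simp only: adm)
    then have "vec n (\<lambda>i. real (perm_inv u i)) $ u' k \<le> vec n (\<lambda>i. real (perm_inv u i)) $ u k"
      using mem unfolding fixed_point_cone_def by blast
    then have "perm_inv u (u' k) \<le> perm_inv u (u k)"
      using less.prems by (simp add: permutes_lessThan_iff[OF u] permutes_lessThan_iff[OF u'])
    moreover have "k \<le> perm_inv u (u' k)"
      using admissible_self[OF u' le(2) \<open>k < n\<close>] permutes_notin_image_lessThan[OF u]
      by (simp add: admissible_def img)
    ultimately show ?case by (metis le_antisym permutes_inverses u)
  qed
  show ?thesis
  proof
    fix k show "u' k = u k"
      using *[of k] by (cases "k < n") (simp_all add: permutes_not_in[OF u] permutes_not_in[OF u'])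
  qed
qed

section \<open>Flag minors\<close>

text \<open>Rows and columns are index functions rather than sorted sets, so a permutation can serve
  directly as a list of rows. The order of the rows affects only the sign, and repeated rows give
  zero.\<close>

definition minor :: "nat \<Rightarrow> (nat \<Rightarrow> nat) \<Rightarrow> (nat \<Rightarrow> nat) \<Rightarrow> 'a mat \<Rightarrow> 'a :: comm_ring_1" where
  "minor k f h g = det (mat k k (\<lambda>(r, c). g $$ (f r, h c)))"

abbreviation flag_minor :: "nat \<Rightarrow> (nat \<Rightarrow> nat) \<Rightarrow> 'a mat \<Rightarrow> 'a :: comm_ring_1" where
  "flag_minor k f \<equiv> minor k f (\<lambda>c. c)"

lemma minor_cong:
  assumes "\<And>r. r < k \<Longrightarrow> f r = f' r"
  shows "minor k f h g = minor k f' h g"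
  unfolding minor_def by (rule arg_cong[of _ _ det], rule cong_mat) (use assms in auto)

lemma minor_expand:
  "minor k f h g = (\<Sum>p\<in>{p. p permutes {0..<k}}. signof p * (\<Prod>i = 0..<k. g $$ (f i, h (p i))))"
  unfolding minor_def
  by (subst det_def'[of _ k], simp, intro sum.cong refl arg_cong2[of _ _ _ _ "(*)"] prod.cong)
    (auto simp: permutes_in_image)

lemma minor_eq_0:
  assumes "r \<noteq> s" "r < k" "s < k" "f r = f s"
  shows "minor k f h g = 0"
  unfolding minor_def
proof (rule det_identical_rows)
  show "row (mat k k (\<lambda>(r, c). g $$ (f r, h c))) r = row (mat k k (\<lambda>(r, c). g $$ (f r, h c))) s"
    using assms by (intro eq_vecI) auto
qed (use assms in auto)

lemma minor_nonzero_imp_inj_on: "minor k f h g \<noteq> 0 \<Longrightarrow> inj_on f {..<k}"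
  using minor_eq_0 by (fastforce intro: inj_onI)

text \<open>The first \<open>k\<close> columns of \<open>g * b\<close> involve only the first
  \<open>k\<close> columns of \<open>g\<close>, so the submatrix factors through the leading block
  of \<open>b\<close>. Hence quotients of flag minors of equal size are functions on
  \<open>G/B\<close>.\<close>

lemma minor_mult_upper_triangular:
  fixes g b :: "'a :: idom mat"
  assumes g: "g \<in> carrier_mat n n" and b: "b \<in> carrier_mat n n" "upper_triangular b"
    and k: "k \<le> n" and f: "f ` {..<k} \<subseteq> {..<n}"
  shows "flag_minor k f (g * b) = flag_minor k f g * (\<Prod>i<k. b $$ (i, i))"
proof -
  let ?g = "mat k k (\<lambda>(r, c). g $$ (f r, c))" and ?b = "mat k k (\<lambda>(r, c). b $$ (r, c))"
  have "mat k k (\<lambda>(r, c). (g * b) $$ (f r, c)) = ?g * ?b"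
  proof (rule eq_matI)
    fix r c assume "r < dim_row (?g * ?b)" "c < dim_col (?g * ?b)"
    then have rc: "r < k" "c < k" by auto
    then have "f r < n" using f by auto
    have "(g * b) $$ (f r, c) = (\<Sum>l<n. g $$ (f r, l) * b $$ (l, c))"
      using g b rc k \<open>f r < n\<close> by (simp add: scalar_prod_def atLeast0LessThan)
    also have "\<dots> = (\<Sum>l<k. g $$ (f r, l) * b $$ (l, c))"
      using rc k b by (intro sum.mono_neutral_right) (auto simp: upper_triangular_def)
    also have "\<dots> = (?g * ?b) $$ (r, c)"
      using rc by (simp add: scalar_prod_def atLeast0LessThan)
    finally show "mat k k (\<lambda>(r, c). (g * b) $$ (f r, c)) $$ (r, c) = (?g * ?b) $$ (r, c)"
      using rc by simp
  qed auto
  moreover have "det ?b = prod_list (diag_mat ?b)"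
    by (rule det_upper_triangular[of _ k]) (use b k in \<open>auto simp: upper_triangular_def\<close>)
  moreover have "prod_list (diag_mat ?b) = (\<Prod>i<k. b $$ (i, i))"
    by (simp add: diag_mat_def prod.list_conv_set_nth atLeast0LessThan)
  ultimately show ?thesis
    unfolding minor_def by (simp add: det_mult[of _ k])
qed

section \<open>Diagonal matrices and torus weights of minors\<close>

definition dmat :: "nat \<Rightarrow> (nat \<Rightarrow> 'a) \<Rightarrow> 'a :: semiring_1 mat" where
  "dmat n d = mat n n (\<lambda>(i, j). if i = j then d i else 0)"

lemma dmat_carrier [simp]: "dmat n d \<in> carrier_mat n n"
  and dmat_dim [simp]: "dim_row (dmat n d) = n" "dim_col (dmat n d) = n"
  and dmat_index [simp]: "i < n \<Longrightarrow> j < n \<Longrightarrow> dmat n d $$ (i, j) = (if i = j then d i else 0)"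
  by (simp_all add: dmat_def)

lemma index_dmat_mult:
  assumes "g \<in> carrier_mat n n" "i < n" "j < n"
  shows "(dmat n d * g) $$ (i, j) = d i * g $$ (i, j)"
proof -
  have "(dmat n d * g) $$ (i, j) = (\<Sum>l<n. (if i = l then d i else 0) * g $$ (l, j))"
    using assms by (simp add: scalar_prod_def atLeast0LessThan)
  also have "\<dots> = (\<Sum>l<n. if i = l then d i * g $$ (l, j) else 0)" by (intro sum.cong) auto
  finally show ?thesis using assms by simp
qed

lemma index_mult_dmat:
  assumes "g \<in> carrier_mat n n" "i < n" "j < n"
  shows "(g * dmat n d) $$ (i, j) = g $$ (i, j) * d j"
proof -
  have "(g * dmat n d) $$ (i, j) = (\<Sum>l<n. g $$ (i, l) * (if l = j then d l else 0))"
    using assms by (simp add: scalar_prod_def atLeast0LessThan)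
  also have "\<dots> = (\<Sum>l<n. if l = j then g $$ (i, l) * d l else 0)" by (intro sum.cong) auto
  finally show ?thesis using assms by simp
qed

text \<open>Each term of the Leibniz expansion takes one entry from every row, so a flag minor is a
  weight vector whose weight is given by its rows.\<close>

lemma minor_dmat_mult:
  assumes g: "g \<in> carrier_mat n n" and "f ` {..<k} \<subseteq> {..<n}" "k \<le> n"
  shows "flag_minor k f (dmat n d * g) = (\<Prod>r<k. d (f r)) * flag_minor k f g"
proof -
  have "(\<Prod>i = 0..<k. (dmat n d * g) $$ (f i, p i)) = (\<Prod>r<k. d (f r)) * (\<Prod>i =
    0..<k. g $$ (f i, p i))"
    if "p permutes {0..<k}" for p
  proof -
    have "(\<Prod>i = 0..<k. (dmat n d * g) $$ (f i, p i)) = (\<Prod>i = 0..<k. d (f i) * g $$ (f i, p i))"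
    proof (rule prod.cong[OF refl])
      fix i assume "i \<in> {0..<k}"
      then have "p i < k" using permutes_in_image[OF that, of i] by simp
      with \<open>i \<in> {0..<k}\<close> show "(dmat n d * g) $$ (f i, p i) = d (f i) * g $$ (f i, p i)"
        using assms by (intro index_dmat_mult) auto
    qed
    then show ?thesis by (simp add: prod.distrib atLeast0LessThan)
  qed
  then show ?thesis unfolding minor_expand by (simp add: sum_distrib_left mult_ac)
qed

text \<open>The coefficients are the cofactors along the last row.\<close>

lemma minor_expand_last_row:
  "\<exists>C. (\<forall>i. flag_minor (Suc k) (f(k := i)) g = (\<Sum>c<Suc k. g $$ (i, c) * C c)) \<and> C k =
    flag_minor k f g"
proof -
  define C where "C c = (-1) ^ (k + c) *
    det (mat k k (\<lambda>(r, j). g $$ (f r, if j < c then j else Suc j)))" for c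
  have "flag_minor (Suc k) (f(k := i)) g = (\<Sum>c<Suc k. g $$ (i, c) * C c)" for i
  proof -
    define A where "A = mat (Suc k) (Suc k) (\<lambda>(r, c). g $$ ((f(k := i)) r, c))"
    have A: "A \<in> carrier_mat (Suc k) (Suc k)" by (simp add: A_def)
    have "cofactor A k c = C c" if "c < Suc k" for c
      unfolding cofactor_def C_def
      by (rule arg_cong[of _ _ "\<lambda>M. (-1) ^ (k + c) * det M"])
        (use that in \<open>auto simp: mat_delete_def A_def intro!: eq_matI\<close>)
    moreover have "det A = (\<Sum>c<Suc k. A $$ (k, c) * cofactor A k c)"
      by (rule laplace_expansion_row[OF A]) simp
    ultimately show ?thesis
      unfolding minor_def A_def[symmetric] by (simp add: A_def)
  qed
  moreover have "C k = flag_minor k f g"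
    unfolding C_def minor_def
    by (simp add: power_add flip: power_mult_distrib)
      (rule arg_cong[of _ _ det], auto intro!: eq_matI)
  ultimately show ?thesis by blast
qed

section \<open>Permutations with nonvanishing flag minors\<close>

lemma invertible_mat_iff_det:
  fixes g :: "'a :: field mat"
  assumes g: "g \<in> carrier_mat n n"
  shows "invertible_mat g \<longleftrightarrow> det g \<noteq> 0"
proof
  assume "invertible_mat g"
  then obtain h where h: "g * h = 1\<^sub>m n" "h * g = 1\<^sub>m (dim_row h)"
    using g by (auto simp: invertible_mat_def inverts_mat_def)
  then have "h \<in> carrier_mat n n"
    by (metis carrier_matD(2) carrier_matI g index_mult_mat(2,3) index_one_mat(2,3))
  with h g have "det g * det h = 1" by (metis det_mult det_one)
  then show "det g \<noteq> 0" by auto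
next
  assume "det g \<noteq> 0"
  from det_non_zero_imp_unit[OF g this, of "()"]
  obtain h where "h \<in> carrier_mat n n" "h * g = 1\<^sub>m n" "g * h = 1\<^sub>m n"
    by (auto simp: Units_def ring_mat_def)
  with g show "invertible_mat g"
    by (auto simp: invertible_mat_def inverts_mat_def intro!: exI[of _ h])
qed

text \<open>If all bordered minors vanished, the cofactors along the new row, padded by zeros, would
  lie in the kernel of \<open>g\<close>. This vector is nonzero, because its entry \<open>k\<close>
  is the given minor.\<close>

lemma minor_extend:
  fixes g :: "'a :: field mat"
  assumes g: "g \<in> carrier_mat n n" "det g \<noteq> 0" and k: "k < n" and nz: "flag_minor k f g \<noteq> 0"
  shows "\<exists>i<n. flag_minor (Suc k) (f(k := i)) g \<noteq> 0"
proof (rule ccontr)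
  assume "\<not> ?thesis"
  then have 0: "flag_minor (Suc k) (f(k := i)) g = 0" if "i < n" for i using that by blast
  obtain C where C: "\<And>i. flag_minor (Suc k) (f(k := i)) g = (\<Sum>c<Suc k. g $$ (i, c) * C c)"
    and Ck: "C k = flag_minor k f g"
    using minor_expand_last_row by blast
  define v where "v = vec n (\<lambda>c. if c < Suc k then C c else 0)"
  have "g *\<^sub>v v = 0\<^sub>v n"
  proof (rule eq_vecI)
    fix i assume "i < dim_vec (0\<^sub>v n :: 'a vec)"
    then have i: "i < n" by simp
    have "(g *\<^sub>v v) $ i = (\<Sum>c<n. g $$ (i, c) * (if c < Suc k then C c else 0))"
      using g i by (simp add: v_def scalar_prod_def atLeast0LessThan)
    also have "\<dots> = (\<Sum>c<Suc k. g $$ (i, c) * C c)"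
      using k by (intro sum.mono_neutral_cong_right) auto
    finally show "(g *\<^sub>v v) $ i = 0\<^sub>v n $ i" using C[of i] 0[OF i] i by simp
  qed (use g in simp)
  moreover have "v \<noteq> 0\<^sub>v n"
  proof
    assume "v = 0\<^sub>v n"
    then have "v $ k = 0" using k by simp
    then show False using k Ck nz by (simp add: v_def)
  qed
  moreover have "v \<in> carrier_vec n" by (simp add: v_def)
  ultimately show False using det_0_iff_vec_prod_zero_field[OF g(1)] g(2) by blast
qed

text \<open>Rows are chosen one at a time by \<open>minor_extend\<close>, and they are distinct
  because a minor with a repeated row vanishes. Geometrically, the charts around the torus-fixed
  points cover the flag variety.\<close>

lemma exists_permutation_minors_nonzero:
  fixes g :: "'a :: field mat"
  assumes g: "g \<in> carrier_mat n n" "det g \<noteq> 0"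
  shows "\<exists>u. u permutes {..<n} \<and> (\<forall>k\<le>n. flag_minor k u g \<noteq> 0)"
proof -
  have "\<exists>f. f ` {..<k} \<subseteq> {..<n} \<and> (\<forall>j\<le>k. flag_minor j f g \<noteq> 0)" if k: "k \<le> n" for k
    using k
  proof (induction k)
    case 0
    show ?case by (auto simp: minor_def)
  next
    case (Suc k)
    then obtain f where f: "f ` {..<k} \<subseteq> {..<n}" "\<forall>j\<le>k. flag_minor j f g \<noteq> 0" by auto
    obtain i where i: "i < n" "flag_minor (Suc k) (f(k := i)) g \<noteq> 0"
      using minor_extend[OF g, of k f] Suc.prems f by auto
    have "flag_minor j (f(k := i)) g = flag_minor j f g" if "j \<le> k" for j
      using that by (intro minor_cong) auto
    then have "\<forall>j\<le>Suc k. flag_minor j (f(k := i)) g \<noteq> 0"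
      using f i by (metis le_SucE)
    moreover have "(f(k := i)) ` {..<Suc k} \<subseteq> {..<n}" using f i by (auto simp: lessThan_Suc)
    ultimately show ?case by blast
  qed
  then obtain f where f: "f ` {..<n} \<subseteq> {..<n}" and nz: "\<forall>j\<le>n. flag_minor j f g \<noteq> 0" by blast
  define u where "u j = (if j < n then f j else j)" for j
  have "inj_on f {..<n}" using nz minor_nonzero_imp_inj_on by blast
  then have "bij_betw f {..<n} {..<n}" using f by (intro bij_betw_imageI endo_inj_surj) auto
  then have "bij_betw u {..<n} {..<n}"
    by (rule bij_betw_cong[THEN iffD1, rotated]) (simp add: u_def)
  then have "u permutes {..<n}" by (rule bij_imp_permutes) (simp add: u_def)
  moreover have "flag_minor k u g = flag_minor k f g" if "k \<le> n" for k
    using that by (intro minor_cong) (simp add: u_def)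
  ultimately show ?thesis using nz by auto
qed

text \<open>Column \<open>k\<close> of \<open>b\<close> holds the cofactors along the last row of
  the bordered minors of size \<open>Suc k\<close>. Its diagonal entry is
  \<open>flag_minor k u g\<close>, which makes \<open>b\<close> invertible.\<close>

lemma exists_minor_echelon:
  fixes g :: "'a :: field mat"
  assumes g: "g \<in> carrier_mat n n" and nz: "\<And>k. k < n \<Longrightarrow> flag_minor k u g \<noteq> 0"
  shows "\<exists>b \<in> carrier_mat n n. upper_triangular b \<and> (\<forall>i<n. b $$ (i, i) \<noteq> 0) \<and>
    (\<forall>i<n. \<forall>k<n. (g * b) $$ (i, k) = flag_minor (Suc k) (u(k := i)) g)"
proof -
  have "\<exists>C. \<forall>k. (\<forall>i. flag_minor (Suc k) (u(k := i)) g = (\<Sum>c<Suc k. g $$ (i, c) * C k c))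
      \<and> C k k = flag_minor k u g"
    using minor_expand_last_row by (intro choice allI)
  then obtain C where C: "\<And>k i. flag_minor (Suc k) (u(k := i)) g = (\<Sum>c<Suc k. g $$ (i, c) * C k c)"
    and Ck: "\<And>k. C k k = flag_minor k u g" by blast
  define b where "b = mat n n (\<lambda>(c, k). if c \<le> k then C k c else 0)"
  have "(g * b) $$ (i, k) = flag_minor (Suc k) (u(k := i)) g" if "i < n" "k < n" for i k
  proof -
    have "(g * b) $$ (i, k) = (\<Sum>c<n. g $$ (i, c) * (if c \<le> k then C k c else 0))"
      using g that by (simp add: b_def scalar_prod_def atLeast0LessThan)
    also have "\<dots> = (\<Sum>c<Suc k. g $$ (i, c) * C k c)"
      using that by (intro sum.mono_neutral_cong_right) auto
    finally show ?thesis by (simp only: C)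
  qed
  moreover have "upper_triangular b" "b \<in> carrier_mat n n" "\<forall>i<n. b $$ (i, i) \<noteq> 0"
    using nz Ck by (auto simp: b_def upper_triangular_def)
  ultimately show ?thesis by blast
qed

section \<open>Limits of torus curves in the flag variety\<close>

lemma GL_iff: "g \<in> GL n \<longleftrightarrow> g \<in> carrier_mat n n \<and> det g \<noteq> 0"
  by (auto simp: GL_def invertible_mat_iff_det)

lemma GL_mult: "g \<in> GL n \<Longrightarrow> h \<in> GL n \<Longrightarrow> g * h \<in> GL n"
  by (auto simp: GL_iff det_mult)

lemma borel_iff:
  "b \<in> borel_subgroup n \<longleftrightarrow> b \<in> carrier_mat n n \<and> upper_triangular b \<and> (\<forall>i<n. b $$ (i, i) \<noteq> 0)"
proof -
  have "det b \<noteq> 0 \<longleftrightarrow> (\<forall>i<n. b $$ (i, i) \<noteq> 0)" if "b \<in> carrier_mat n n" "upper_triangular b"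
    using that by (auto simp: det_upper_triangular diag_mat_def prod_list_zero_iff)
  then show ?thesis by (auto simp: borel_subgroup_def GL_iff)
qed

lemma borel_carrier: "b \<in> borel_subgroup n \<Longrightarrow> b \<in> carrier_mat n n"
  and borel_GL: "b \<in> borel_subgroup n \<Longrightarrow> b \<in> GL n"
  by (simp_all add: borel_subgroup_def GL_iff)

lemma borel_one: "1\<^sub>m n \<in> borel_subgroup n"
  by (auto simp: borel_iff upper_triangular_def)

lemma borel_mult:
  assumes "b \<in> borel_subgroup n" "c \<in> borel_subgroup n"
  shows "b * c \<in> borel_subgroup n"
proof -
  have bc: "b \<in> carrier_mat n n" "c \<in> carrier_mat n n" using assms by (auto simp: borel_carrier)
  have "(b * c) $$ (i, j) = 0" if "j < i" "i < n" for i j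
  proof -
    have "(b * c) $$ (i, j) = (\<Sum>l<n. b $$ (i, l) * c $$ (l, j))"
      using bc that by (simp add: scalar_prod_def atLeast0LessThan)
    also have "\<dots> = 0"
    proof (intro sum.neutral ballI)
      fix l assume "l \<in> {..<n}"
      then show "b $$ (i, l) * c $$ (l, j) = 0"
        using assms bc that by (cases "l < i") (auto simp: borel_iff upper_triangular_def)
    qed
    finally show ?thesis .
  qed
  then have "upper_triangular (b * c)" using bc by (auto simp: upper_triangular_def)
  then show ?thesis
    using GL_mult[of b n c] assms by (simp add: borel_subgroup_def)
qed

lemma borel_inverse:
  assumes b: "b \<in> borel_subgroup n"
  shows "\<exists>c\<in>borel_subgroup n. b * c = 1\<^sub>m n"
proof -
  have bc: "b \<in> carrier_mat n n" "det b \<noteq> 0" "upper_triangular b" "\<And>i. i < n \<Longrightarrow> b $$ (i, i) \<noteq> 0"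
    using b borel_GL[OF b] by (simp_all add: borel_iff GL_iff)
  from det_non_zero_imp_unit[OF bc(1,2), of "()"]
  obtain c where c: "c \<in> carrier_mat n n" "b * c = 1\<^sub>m n"
    by (auto simp: Units_def ring_mat_def)
  \<comment> \<open>Induction from the bottom row upwards: in the expansion of entry
    \<open>(i, j)\<close> of \<open>b * c = 1\<close>, terms left of the diagonal of
    \<open>b\<close> vanish and those right of it vanish by induction, which leaves
    \<open>b $$ (i, i) * c $$ (i, j)\<close>.\<close>
  have "c $$ (i, j) = 0" if "j < i" "i < n" for i j
    using that
  proof (induction "n - i" arbitrary: i rule: less_induct)
    case less
    have "0 = (b * c) $$ (i, j)" using less.prems c(1) unfolding c(2) by simp
    also have "\<dots> = (\<Sum>l<n. b $$ (i, l) * c $$ (l, j))"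
      using bc(1) c(1) less.prems by (simp add: scalar_prod_def atLeast0LessThan)
    also have "\<dots> = (\<Sum>l\<in>{i}. b $$ (i, l) * c $$ (l, j))"
    proof (intro sum.mono_neutral_right ballI)
      fix l assume "l \<in> {..<n} - {i}"
      then consider "l < i" | "i < l" "l < n" by fastforce
      then show "b $$ (i, l) * c $$ (l, j) = 0"
      proof cases
        case 1
        then have "b $$ (i, l) = 0" using bc(1,3) less.prems by (simp add: upper_triangular_def)
        then show ?thesis by simp
      next
        case 2
        then have "c $$ (l, j) = 0" using less.hyps[of l] less.prems by simp
        then show ?thesis by simp
      qed
    qed (use less.prems in auto)
    finally show ?case using bc(4) less.prems by simp
  qed
  then have "upper_triangular c" using c(1) by (auto simp: upper_triangular_def)
  moreover have "det c \<noteq> 0" using det_mult[OF bc(1) c(1)] unfolding c(2) by auto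
  ultimately show ?thesis using c by (intro bexI[of _ c]) (simp_all add: borel_subgroup_def GL_iff)
qed

lemma dmat_torus: "(\<And>i. i < n \<Longrightarrow> d i \<noteq> 0) \<Longrightarrow> dmat n d \<in> torus n"
  and dmat_borel: "(\<And>i. i < n \<Longrightarrow> d i \<noteq> 0) \<Longrightarrow> dmat n d \<in> borel_subgroup n"
proof -
  assume d: "\<And>i. i < n \<Longrightarrow> d i \<noteq> 0"
  show "dmat n d \<in> borel_subgroup n" using d by (auto simp: borel_iff upper_triangular_def)
  then show "dmat n d \<in> torus n" by (auto simp: torus_def borel_GL diagonal_mat_def)
qed

lemma torus_eq_dmat:
  assumes "t \<in> torus n"
  shows "t = dmat n (\<lambda>i. t $$ (i, i))" "\<And>i. i < n \<Longrightarrow> t $$ (i, i) \<noteq> 0"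
proof -
  have t: "t \<in> carrier_mat n n" "diagonal_mat t" "det t \<noteq> 0" using assms
    by (auto simp: torus_def GL_iff)
  then show "t = dmat n (\<lambda>i. t $$ (i, i))" by (intro eq_matI) (auto simp: diagonal_mat_def)
  have "upper_triangular t" using t by (auto simp: upper_triangular_def diagonal_mat_def)
  with t have "t \<in> borel_subgroup n" by (simp add: borel_subgroup_def GL_iff)
  then show "\<And>i. i < n \<Longrightarrow> t $$ (i, i) \<noteq> 0" by (simp add: borel_iff)
qed

lemma torus_imp_dmat:
  assumes "t \<in> torus n"
  shows "\<exists>d. (\<forall>i<n. d i \<noteq> 0) \<and> t = dmat n d"
  using torus_eq_dmat[OF assms] by (intro exI[of _ "\<lambda>i. t $$ (i, i)"] conjI allI impI)

lemma torus_GL: "t \<in> torus n \<Longrightarrow> t \<in> GL n"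
  by (simp add: torus_def)

section \<open>Cosets and the torus action\<close>

lemma coset_self: "g \<in> carrier_mat n n \<Longrightarrow> g \<in> coset n g"
  unfolding coset_def using borel_one by (auto intro!: image_eqI[of _ _ "1\<^sub>m n"])

lemma coset_mult_borel:
  assumes g: "g \<in> carrier_mat n n" and b: "b \<in> borel_subgroup n"
  shows "coset n (g * b) = coset n g"
proof -
  obtain c where c: "c \<in> borel_subgroup n" "b * c = 1\<^sub>m n" using borel_inverse[OF b] by blast
  note carr = g borel_carrier[OF b] borel_carrier[OF c(1)]
  show ?thesis unfolding coset_def
  proof (intro equalityI subsetI)
    fix x assume "x \<in> (*) (g * b) ` borel_subgroup n"
    then obtain d where d: "d \<in> borel_subgroup n" "x = g * b * d" by blast
    then have "x = g * (b * d)" using carr borel_carrier[OF d(1)] by (simp add: assoc_mult_mat)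
    then show "x \<in> (*) g ` borel_subgroup n" using borel_mult[OF b d(1)] by blast
  next
    fix x assume "x \<in> (*) g ` borel_subgroup n"
    then obtain d where d: "d \<in> borel_subgroup n" "x = g * d" by blast
    have "b * (c * d) = d"
      using carr borel_carrier[OF d(1)] c(2) by (metis assoc_mult_mat left_mult_one_mat)
    then have "x = g * b * (c * d)"
      using carr d borel_carrier[OF d(1)] by (metis assoc_mult_mat mult_carrier_mat)
    then show "x \<in> (*) (g * b) ` borel_subgroup n" using borel_mult[OF c(1) d(1)] by blast
  qed
qed

lemma act_coset:
  assumes "t \<in> carrier_mat n n" "g \<in> carrier_mat n n"
  shows "act t (coset n g) = coset n (t * g)"
  unfolding act_def coset_def image_image
  using assms by (intro image_cong refl) (metis assoc_mult_mat borel_carrier)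

lemma coset_in_flag_variety: "g \<in> GL n \<Longrightarrow> coset n g \<in> flag_variety n"
  by (simp add: flag_variety_def)

text \<open>The factor \<open>c\<close> is the same for all rows \<open>f\<close>: the flag minors
  of size \<open>k\<close> are homogeneous (Pluecker) coordinates of the flag.\<close>

lemma flag_minor_coset:
  assumes g: "g \<in> carrier_mat n n" and h: "h \<in> coset n g" and k: "k \<le> n"
  shows "\<exists>c. c \<noteq> 0 \<and> (\<forall>f. f ` {..<k} \<subseteq> {..<n} \<longrightarrow> flag_minor k f h = flag_minor k f g * c)"
proof -
  obtain b where b: "b \<in> borel_subgroup n" "h = g * b" using h by (auto simp: coset_def)
  then have "b \<in> carrier_mat n n" "upper_triangular b" "(\<Prod>i<k. b $$ (i, i)) \<noteq> 0"
    using k by (auto simp: borel_iff)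
  then show ?thesis
    using minor_mult_upper_triangular[OF g _ _ k, of b] b by blast
qed

section \<open>Polynomial functions, Zariski open sets and limits\<close>

lemma poly_fun_sum:
  "(\<And>x. x \<in> S \<Longrightarrow> (\<lambda>g. F x g) \<in> poly_fun n) \<Longrightarrow> (\<lambda>g. \<Sum>x\<in>S. F x g) \<in> poly_fun n"
  by (induction S rule: infinite_finite_induct) (simp_all add: poly_fun.intros)

lemma poly_fun_prod:
  "(\<And>x. x \<in> S \<Longrightarrow> (\<lambda>g. F x g) \<in> poly_fun n) \<Longrightarrow> (\<lambda>g. \<Prod>x\<in>S. F x g) \<in> poly_fun n"
  by (induction S rule: infinite_finite_induct) (simp_all add: poly_fun.intros)

lemma poly_fun_minor:
  assumes f: "f ` {..<k} \<subseteq> {..<n}" and h: "h ` {..<k} \<subseteq> {..<n}"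
  shows "minor k f h \<in> poly_fun n"
proof -
  have "(\<lambda>g. \<Sum>p\<in>{p. p permutes {0..<k}}. signof p * (\<Prod>i = 0..<k. g $$ (f i, h (p i)))) \<in> poly_fun n"
  proof (intro poly_fun_sum poly_fun.mult poly_fun_prod poly_fun.const poly_fun.entry)
    fix p i assume p: "p \<in> {p. p permutes {0..<k}}" and i: "i \<in> {0..<k}"
    show "f i < n" using f i by auto
    have "p i < k" using p i permutes_in_image[of p "{0..<k}" i] by auto
    then show "h (p i) < n" using h by auto
  qed
  moreover have "minor k f h = (\<lambda>g. \<Sum>p\<in>{p. p permutes {0..<k}}. signof p * (\<Prod>i =
    0..<k. g $$ (f i, h (p i)) :: complex))"
    by (rule ext) (rule minor_expand)
  ultimately show ?thesis by simp
qed

lemma poly_fun_tendsto: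
  assumes "p \<in> poly_fun n" and "\<And>i j. i < n \<Longrightarrow> j < n \<Longrightarrow> ((\<lambda>s. G s $$ (i, j)) \<longlongrightarrow> A $$ (i, j)) F"
  shows "((\<lambda>s. p (G s)) \<longlongrightarrow> p A) F"
  using assms(1) by induction (auto intro: tendsto_intros assms(2))

text \<open>Zariski open sets are open for entrywise convergence, because polynomials are continuous
  and the property survives finite intersections and unions. Analytic limits can therefore be used
  inside the Zariski topology.\<close>

lemma openin_GL_eventually:
  assumes S: "openin (GL_topology n) S" "A \<in> S"
    and G: "\<forall>\<^sub>F s in F. G s \<in> GL n"
    and lim: "\<And>i j. i < n \<Longrightarrow> j < n \<Longrightarrow> ((\<lambda>s. G s $$ (i, j)) \<longlongrightarrow> A $$ (i, j)) F"
  shows "\<forall>\<^sub>F s in F. G s \<in> S"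
proof -
  have "generate_topology_on ((\<lambda>p. {g \<in> GL n. p g \<noteq> 0}) ` poly_fun n) S"
    using S(1) unfolding GL_topology_def openin_topology_generated_by_iff .
  then show ?thesis using S(2)
  proof induction
    case (Int a b)
    then show ?case by (auto intro: eventually_conj)
  next
    case (UN K)
    then obtain k where "k \<in> K" "A \<in> k" by blast
    then have "\<forall>\<^sub>F s in F. G s \<in> k" by (intro UN(2))
    then show ?case using \<open>k \<in> K\<close> by (auto elim!: eventually_mono)
  next
    case (Basis s)
    then obtain p where p: "p \<in> poly_fun n" "s = {g \<in> GL n. p g \<noteq> 0}" by blast
    have "((\<lambda>s. p (G s)) \<longlongrightarrow> p A) F" using p(1) lim by (rule poly_fun_tendsto)
    then have "\<forall>\<^sub>F s in F. p (G s) \<noteq> 0"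
      using Basis p by (intro tendsto_imp_eventually_ne) auto
    with G show ?case unfolding p(2) by eventually_elim simp
  qed simp
qed

lemma topspace_flag_topology [simp]: "topspace (flag_topology n) = flag_variety n"
proof -
  \<comment> \<open>The constant polynomial 1 exhibits \<open>GL n\<close> as a basic open
    set.\<close>
  have "{g \<in> GL n. coset n g \<in> flag_variety n} = {g \<in> GL n. (1::complex) \<noteq> 0}"
    by (auto simp: coset_in_flag_variety)
  also have "openin (GL_topology n) \<dots>"
    unfolding GL_topology_def
    by (intro topology_generated_by_Basis) (auto intro!: image_eqI[of _ _ "\<lambda>_. 1"] poly_fun.const)
  finally have "openin (flag_topology n) (flag_variety n)"
    by (simp add: openin_flag_topology)
  then show ?thesis by (metis openin_flag_topology openin_subset openin_topspace subset_antisym)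
qed

section \<open>Charts given by nonvanishing minors\<close>

definition minor_chart :: "nat \<Rightarrow> nat \<Rightarrow> (nat \<Rightarrow> nat) \<Rightarrow> complex mat set set" where
  "minor_chart n k f = {x \<in> flag_variety n. \<forall>g\<in>x. flag_minor k f g \<noteq> 0}"

lemma coset_in_minor_chart_iff:
  assumes g: "g \<in> GL n" and k: "k \<le> n" and f: "f ` {..<k} \<subseteq> {..<n}"
  shows "coset n g \<in> minor_chart n k f \<longleftrightarrow> flag_minor k f g \<noteq> 0"
proof -
  have g': "g \<in> carrier_mat n n" using g by (simp add: GL_iff)
  have "flag_minor k f h \<noteq> 0" if "h \<in> coset n g" "flag_minor k f g \<noteq> 0" for h
    using flag_minor_coset[OF g' that(1) k] f that(2) by auto
  then show ?thesis
    using coset_self[OF g'] g by (auto simp: minor_chart_def coset_in_flag_variety)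
qed

lemma openin_minor_chart:
  assumes k: "k \<le> n" and f: "f ` {..<k} \<subseteq> {..<n}"
  shows "openin (flag_topology n) (minor_chart n k f)"
proof -
  have "{g \<in> GL n. coset n g \<in> minor_chart n k f} = {g \<in> GL n. flag_minor k f g \<noteq> 0}"
    using coset_in_minor_chart_iff[OF _ k f] by auto
  moreover have "flag_minor k f \<in> poly_fun n" using k f by (intro poly_fun_minor) auto
  ultimately have "openin (GL_topology n) {g \<in> GL n. coset n g \<in> minor_chart n k f}"
    unfolding GL_topology_def by (auto intro!: topology_generated_by_Basis)
  then show ?thesis by (auto simp: openin_flag_topology minor_chart_def)
qed

text \<open>The chart is an open neighbourhood of the point, so it meets \<open>S\<close>. This
  carries nonvanishing of minors from limit points back to orbits and Schubert cells.\<close>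

lemma closure_of_minor_nonzero:
  assumes z: "coset n g \<in> flag_topology n closure_of S" and g: "g \<in> GL n"
    and k: "k \<le> n" and f: "f ` {..<k} \<subseteq> {..<n}" and nz: "flag_minor k f g \<noteq> 0"
  shows "\<exists>x\<in>S. x \<in> minor_chart n k f"
  using z openin_minor_chart[OF k f] nz unfolding in_closure_of coset_in_minor_chart_iff[OF g k f,
    symmetric]
  by blast

section \<open>Permutation matrices as torus-fixed points and limits\<close>

lemma perm_mat_carrier [simp]: "perm_mat n u \<in> carrier_mat n n"
  and perm_mat_dim [simp]: "dim_row (perm_mat n u) = n" "dim_col (perm_mat n u) = n"
  by (simp_all add: perm_mat_def)

lemma perm_mat_index: "i < n \<Longrightarrow> j < n \<Longrightarrow> perm_mat n u $$ (i, j) = (if i = u j then 1 else 0)"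
  by (simp add: perm_mat_def)

lemma flag_minor_perm_mat:
  assumes u: "u permutes {..<n}" and k: "k \<le> n"
  shows "flag_minor k u (perm_mat n u) = 1"
proof -
  have "mat k k (\<lambda>(r, c). perm_mat n u $$ (u r, c)) = 1\<^sub>m k"
    using k injD[OF permutes_inj[OF u]]
    by (intro eq_matI) (auto simp: perm_mat_index permutes_lessThan_iff[OF u])
  then show ?thesis by (simp add: minor_def)
qed

lemma index_mult_perm_mat:
  assumes g: "g \<in> carrier_mat n n" and w: "w permutes {..<n}" and "i < n" "j < n"
  shows "(g * perm_mat n w) $$ (i, j) = g $$ (i, w j)"
proof -
  have "(g * perm_mat n w) $$ (i, j) = (\<Sum>l<n. g $$ (i, l) * (if l = w j then 1 else 0))"
    using assms by (simp add: scalar_prod_def atLeast0LessThan perm_mat_def)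
  also have "\<dots> = (\<Sum>l<n. if l = w j then g $$ (i, l) else 0)" by (intro sum.cong) auto
  finally show ?thesis using assms by (simp add: permutes_lessThan_iff[OF w])
qed

lemma perm_mat_GL:
  assumes u: "u permutes {..<n}"
  shows "perm_mat n u \<in> GL n"
proof -
  have "perm_mat n u * perm_mat n (perm_inv u) = 1\<^sub>m n"
    by (rule eq_matI)
      (auto simp: index_mult_perm_mat[OF perm_mat_carrier permutes_inv[OF u]] perm_mat_index
        permutes_lessThan_inv_iff[OF u] permutes_inverses(1)[OF u] simp del: index_mult_mat(1))
  then have "det (perm_mat n u) * det (perm_mat n (perm_inv u)) = 1"
    by (metis det_mult det_one perm_mat_carrier)
  then show ?thesis by (auto simp: GL_iff)
qed

text \<open>A diagonal matrix moves past the permutation matrix with its entries permuted and is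
  then absorbed by \<open>B\<close>.\<close>

lemma act_torus_perm_mat:
  assumes u: "u permutes {..<n}" and t: "t \<in> torus n"
  shows "act t (coset n (perm_mat n u)) = coset n (perm_mat n u)"
proof -
  obtain d where d: "\<And>i. i < n \<Longrightarrow> d i \<noteq> 0" "t = dmat n d" using torus_imp_dmat[OF t] by blast
  have "dmat n d * perm_mat n u = perm_mat n u * dmat n (\<lambda>j. d (u j))"
    by (rule eq_matI)
      (auto simp: index_dmat_mult index_mult_dmat perm_mat_index simp del: index_mult_mat(1))
  moreover have "dmat n (\<lambda>j. d (u j)) \<in> borel_subgroup n"
    using d by (intro dmat_borel) (simp add: permutes_lessThan_iff[OF u])
  ultimately show ?thesis
    using d coset_mult_borel[OF perm_mat_carrier] by (simp add: act_coset)
qed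

text \<open>Multiplying \<open>g\<close> by the upper triangular matrix of cofactors makes
  \<open>flag_minor (Suc k) (u(k := i)) g\<close> the entry in row \<open>i\<close>, column \<open>k\<close>; the entries in column \<open>k\<close>
  vanish in the rows \<open>u j\<close> for \<open>j < k\<close>.\<close>

lemma torus_limit_perm_mat:
  fixes a :: "nat \<Rightarrow> real"
  assumes u: "u permutes {..<n}" and g: "g \<in> GL n"
    and nz: "\<And>k. k \<le> n \<Longrightarrow> flag_minor k u g \<noteq> 0"
    and a: "\<And>k i. k < n \<Longrightarrow> i < n \<Longrightarrow> i \<noteq> u k \<Longrightarrow> flag_minor (Suc k) (u(k := i)) g \<noteq> 0 \<Longrightarrow> a (u k) < a i"
  shows "\<exists>G :: real \<Rightarrow> complex mat.
    (\<forall>s>0. G s \<in> GL n \<and> coset n (G s) = coset n (dmat n (\<lambda>i. of_real (s powr a i)) * g)) \<and>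
    (\<forall>i<n. \<forall>j<n. ((\<lambda>s. G s $$ (i, j)) \<longlongrightarrow> perm_mat n u $$ (i, j)) (at_right 0))"
proof -
  have g': "g \<in> carrier_mat n n" using g by (simp add: GL_iff)
  obtain b where b: "b \<in> carrier_mat n n" "upper_triangular b" "\<forall>i<n. b $$ (i, i) \<noteq> 0"
    and gb: "\<And>i k. i < n \<Longrightarrow> k < n \<Longrightarrow> (g * b) $$ (i, k) = flag_minor (Suc k) (u(k := i)) g"
    using exists_minor_echelon[OF g', of u] nz by (meson less_imp_le)
  have bB: "b \<in> borel_subgroup n" using b by (simp add: borel_iff)
  define m where "m i k = flag_minor (Suc k) (u(k := i)) g" for i k
  have m_nz: "m (u k) k \<noteq> 0" if "k < n" for k
    using nz[of "Suc k"] that by (simp add: m_def)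
  define T where "T s = dmat n (\<lambda>i. complex_of_real (s powr a i))" for s
  \<comment> \<open>This rescales column \<open>k\<close> so that its entry in row
    \<open>u k\<close> becomes 1. The entry in row \<open>i\<close> then carries the power
    \<open>s powr (a i - a (u k))\<close>, which tends to 0 wherever the minor survives and
    \<open>i\<close> differs from \<open>u k\<close>.\<close>
  define D where "D s = dmat n (\<lambda>k. complex_of_real (s powr (- a (u k))) / m (u k) k)" for s
  define G where "G s = T s * g * (b * D s)" for s
  have D: "D s \<in> borel_subgroup n" if "s > 0" for s
    unfolding D_def using that m_nz by (intro dmat_borel) simp
  have T: "T s \<in> GL n" if "s > 0" for s
    unfolding T_def using that by (intro torus_GL dmat_torus) simp
  have carr: "T s \<in> carrier_mat n n" "D s \<in> carrier_mat n n" for s by (simp_all add: T_def D_def)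
  have "G s \<in> GL n \<and> coset n (G s) = coset n (T s * g)" if s: "s > 0" for s
  proof
    have bD: "b * D s \<in> borel_subgroup n" using bB D[OF s] by (rule borel_mult)
    then show "G s \<in> GL n" unfolding G_def using T[OF s] g by (intro GL_mult borel_GL[of "b * D s"])
    show "coset n (G s) = coset n (T s * g)"
      unfolding G_def by (rule coset_mult_borel[OF mult_carrier_mat[OF carr(1) g'] bD])
  qed
  moreover have "((\<lambda>s. G s $$ (i, k)) \<longlongrightarrow> perm_mat n u $$ (i, k)) (at_right 0)"
    if ik: "i < n" "k < n" for i k
  proof -
    have entry: "G s $$ (i, k) = complex_of_real (s powr (a i - a (u k))) * (m i k / m (u k) k)"
      if "s > 0" for s
    proof -
      have "G s = T s * (g * b * D s)"
        unfolding G_def using g' b carr by (simp add: assoc_mult_mat[of _ n n _ n _ n])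
      also have "\<dots> $$ (i, k) = complex_of_real (s powr a i) * (g * b * D s) $$ (i, k)"
        unfolding T_def using ik g' b(1) carr(2)
          by (intro index_dmat_mult mult_carrier_mat[of _ n n _ n]) auto
      also have "(g * b * D s) $$ (i, k) = (g * b) $$ (i, k) * (complex_of_real (s powr (- a (u
        k))) / m (u k) k)"
        unfolding D_def using ik g' b(1)
          by (intro index_mult_dmat mult_carrier_mat[of _ n n _ n]) auto
      also have "(g * b) $$ (i, k) = m i k" using gb ik by (simp add: m_def)
      also have "complex_of_real (s powr a i) * (m i k * (complex_of_real (s powr (- a (u k))) / m
        (u k) k))
          = complex_of_real (s powr a i * s powr (- a (u k))) * (m i k / m (u k) k)" by simp
      also have "s powr a i * s powr (- a (u k)) = s powr (a i - a (u k))"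
        using that by (simp flip: powr_add)
      finally show ?thesis .
    qed
    have ev: "\<forall>\<^sub>F s in at_right 0. complex_of_real (s powr (a i - a (u k))) * (m i k / m (u k) k)
      = G s $$ (i, k)"
      using entry by (auto simp: eventually_at_right_field intro!: exI[of _ 1])
    have "((\<lambda>s. complex_of_real (s powr (a i - a (u k))) * (m i k / m (u k) k)) \<longlongrightarrow> perm_mat n u $$
      (i, k)) (at_right 0)"
    proof (cases "i = u k")
      case True
      have "\<forall>\<^sub>F s in at_right 0. complex_of_real (s powr (a i - a (u k))) * (m i k / m (u k) k) = 1"
        using m_nz ik True by (auto simp: eventually_at_right_field intro!: exI[of _ 1])
      moreover have "perm_mat n u $$ (i, k) = 1" using True ik by (simp add: perm_mat_index)
      ultimately show ?thesis by (simp only: tendsto_eventually)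
    next
      case False
      show ?thesis
      proof (cases "m i k = 0")
        case True
        with False ik show ?thesis by (simp add: perm_mat_index)
      next
        case m: False
        have "a (u k) < a i" using a[OF ik(2,1) False] m by (simp add: m_def)
        then have "((\<lambda>s. s powr (a i - a (u k))) \<longlongrightarrow> 0) (at_right 0)"
          by (intro tendsto_zero_powrI[where b = "a i - a (u k)"] tendsto_ident_at tendsto_const
            eventually_at_right_less[THEN eventually_mono]) simp_all
        then have "((\<lambda>s. complex_of_real (s powr (a i - a (u k))) * (m i k / m (u k) k)) \<longlongrightarrow>
            complex_of_real 0 * (m i k / m (u k) k)) (at_right 0)"
          by (intro tendsto_mult tendsto_of_real tendsto_const)
        with False ik show ?thesis by (simp add: perm_mat_index)
      qed
    qed
    then show ?thesis using ev by (rule Lim_transform_eventually)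
  qed
  ultimately show ?thesis unfolding T_def by blast
qed

lemma eventually_coset_in_open:
  assumes U: "openin (flag_topology n) U" "coset n A \<in> U" and A: "A \<in> GL n"
    and G: "\<forall>s>(0::real). G s \<in> GL n"
    and lim: "\<forall>i<n. \<forall>j<n. ((\<lambda>s. G s $$ (i, j)) \<longlongrightarrow> A $$ (i, j)) (at_right 0)"
  shows "\<forall>\<^sub>F s in at_right 0. coset n (G s) \<in> U"
proof -
  have "\<forall>\<^sub>F s in at_right 0. G s \<in> {g \<in> GL n. coset n g \<in> U}"
  proof (rule openin_GL_eventually)
    show "\<forall>\<^sub>F s in at_right 0. G s \<in> GL n"
      using G by (auto simp: eventually_at_right_field intro!: exI[of _ 1])
  qed (use U A lim in \<open>auto simp: openin_flag_topology\<close>)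
  then show ?thesis by (rule eventually_mono) simp
qed

section \<open>Fixed points of Schubert varieties\<close>

lemma poly_fun_on_line:
  assumes "p \<in> poly_fun n"
  shows "\<exists>q. \<forall>s. p (mat n n (\<lambda>(i, j). A $$ (i, j) + s * (B $$ (i, j) - A $$ (i, j)))) = poly q s"
  using assms
proof induction
  case (const c)
  show ?case by (intro exI[of _ "[:c:]"]) simp
next
  case (entry i j)
  then show ?case by (intro exI[of _ "[:A $$ (i, j), B $$ (i, j) - A $$ (i, j):]"]) simp
next
  case (add p p')
  then obtain q q' where
    "\<forall>s. p (mat n n (\<lambda>(i, j). A $$ (i, j) + s * (B $$ (i, j) - A $$ (i, j)))) = poly q s"
    "\<forall>s. p' (mat n n (\<lambda>(i, j). A $$ (i, j) + s * (B $$ (i, j) - A $$ (i, j)))) = poly q' s" by blast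
  then show ?case by (intro exI[of _ "q + q'"]) (simp only: poly_add simp_thms)
next
  case (mult p p')
  then obtain q q' where
    "\<forall>s. p (mat n n (\<lambda>(i, j). A $$ (i, j) + s * (B $$ (i, j) - A $$ (i, j)))) = poly q s"
    "\<forall>s. p' (mat n n (\<lambda>(i, j). A $$ (i, j) + s * (B $$ (i, j) - A $$ (i, j)))) = poly q' s" by blast
  then show ?case by (intro exI[of _ "q * q'"]) (simp only: poly_mult simp_thms)
qed

text \<open>The upper triangular matrices form a linear space, on which the nonvanishing loci of
  polynomials are dense: restrict to the line through two given points.\<close>

lemma upper_triangular_common_nonzero:
  assumes "finite P" "P \<subseteq> poly_fun n"
    and "\<And>p. p \<in> P \<Longrightarrow> \<exists>A\<in>carrier_mat n n. upper_triangular A \<and> p A \<noteq> 0"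
  shows "\<exists>A\<in>carrier_mat n n. upper_triangular A \<and> (\<forall>p\<in>P. p A \<noteq> 0)"
  using assms
proof (induction P)
  case empty
  show ?case by (intro bexI[of _ "1\<^sub>m n"]) (auto simp: upper_triangular_def)
next
  case (insert p P)
  obtain A where A: "A \<in> carrier_mat n n" "upper_triangular A" "\<And>p. p \<in> P \<Longrightarrow> p A \<noteq> 0"
    using insert.IH insert.prems by (metis insert_subset insertI2)
  obtain B where B: "B \<in> carrier_mat n n" "upper_triangular B" "p B \<noteq> 0"
    using insert.prems(2)[of p] by auto
  define M where "M s = mat n n (\<lambda>(i, j). A $$ (i, j) + s * (B $$ (i, j) - A $$ (i, j)))" for s
  have "M 0 = A" "M 1 = B" using A B by (auto simp: M_def intro!: eq_matI)
  have "\<exists>q. \<forall>s. p' (M s) = poly q s" if "p' \<in> poly_fun n" for p'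
    unfolding M_def using that by (rule poly_fun_on_line)
  then have "\<exists>Q. \<forall>p'\<in>poly_fun n. \<forall>s. p' (M s) = poly (Q p') s" by metis
  then obtain Q where Q: "\<And>p' s. p' \<in> poly_fun n \<Longrightarrow> p' (M s) = poly (Q p') s" by blast
  \<comment> \<open>\<open>Q p\<close> is nonzero at 1 and the other polynomials are nonzero at 0,
    so their product is a nonzero polynomial and has a point where no factor vanishes.\<close>
  have "Q p \<noteq> 0"
    using Q[of p 1] B(3) insert.prems(1) \<open>M 1 = B\<close> by auto
  moreover have "Q p' \<noteq> 0" if "p' \<in> P" for p'
    using Q[of p' 0] A(3)[OF that] that insert.prems(1) \<open>M 0 = A\<close> by auto
  ultimately have "Q p * (\<Prod>p'\<in>P. Q p') \<noteq> 0" using insert.hyps by simp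
  then obtain s where "poly (Q p * (\<Prod>p'\<in>P. Q p')) s \<noteq> 0"
    using poly_all_0_iff_0 by blast
  then have "\<forall>p'\<in>insert p P. poly (Q p') s \<noteq> 0"
    using insert.hyps by (auto simp: poly_prod)
  then have "\<forall>p'\<in>insert p P. p' (M s) \<noteq> 0"
    using Q[of _ s] insert.prems(1) by (metis subsetD)
  moreover have "upper_triangular (M s)"
    using A B by (auto simp: M_def upper_triangular_def)
  moreover have "M s \<in> carrier_mat n n" by (simp add: M_def)
  ultimately show ?case by blast
qed

text \<open>The witness is the 0-1 matrix of a bijection with \<open>x \<le> \<phi> x\<close>; this
  inequality makes it upper triangular. One term of the Leibniz expansion survives, so the minor is
  a sign.\<close>

lemma exists_upper_triangular_minor_nonzero:
  assumes u: "u permutes {..<n}" and w: "w permutes {..<n}" and k: "k \<le> n"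
    and le: "tuple_le (u ` {..<k}) (w ` {..<k})"
  shows "\<exists>A\<in>carrier_mat n n. upper_triangular A \<and> minor k u w (A :: complex mat) \<noteq> 0"
proof -
  obtain \<phi> where \<phi>: "bij_betw \<phi> (u ` {..<k}) (w ` {..<k})" "\<And>x. x \<in> u ` {..<k} \<Longrightarrow> x \<le> \<phi> x"
    using tuple_le_imp_bij[OF _ _ le] by auto
  define A :: "complex mat" where
    "A = mat n n (\<lambda>(i, j). if i \<in> u ` {..<k} \<and> j = \<phi> i then 1 else 0)"
  have "upper_triangular A"
  proof (rule upper_triangularI)
    fix i j assume "j < i" "i < dim_row A"
    then show "A $$ (i, j) = 0" using \<phi>(2)[of i] by (auto simp: A_def)
  qed
  \<comment> \<open>The permutation of the surviving term: it pairs row \<open>u r\<close> with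
    column \<open>w (p0 r) = \<phi> (u r)\<close>.\<close>
  define p0 where "p0 r = (if r \<in> {0..<k} then perm_inv w (\<phi> (u r)) else r)" for r
  have wp0: "w (p0 r) = \<phi> (u r)" if "r < k" for r
    using that by (simp add: p0_def permutes_inverses(1)[OF w])
  have p0: "p0 permutes {0..<k}"
  proof (rule bij_imp_permutes)
    have "inj_on u {0..<k}" using permutes_inj[OF u] by (rule inj_on_subset) simp
    then have "bij_betw u {0..<k} (u ` {..<k})"
      by (rule bij_betw_imageI) (simp add: atLeast0LessThan)
    moreover have "bij_betw (perm_inv w) (w ` {..<k}) {0..<k}"
    proof (rule bij_betw_imageI)
      show "inj_on (perm_inv w) (w ` {..<k})"
        using permutes_inj[OF permutes_inv[OF w]] by (rule inj_on_subset) simp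
      show "perm_inv w ` w ` {..<k} = {0..<k}"
        by (simp add: image_image permutes_inverses(2)[OF w] atLeast0LessThan)
    qed
    ultimately have "bij_betw (perm_inv w \<circ> (\<phi> \<circ> u)) {0..<k} {0..<k}"
      using \<phi>(1) by (blast intro: bij_betw_trans)
    then show "bij_betw p0 {0..<k} {0..<k}"
      by (rule bij_betw_cong[THEN iffD1, rotated]) (simp add: p0_def)
  qed (auto simp: p0_def)
  have entry: "A $$ (u i, w (p i)) = (if p i = p0 i then 1 else 0)"
    if "p permutes {0..<k}" "i < k" for p i
  proof -
    have "p i < k" using permutes_in_image[OF that(1), of i] that(2) by simp
    then have "p i < n" "i < n" using that(2) k by linarith+
    then have "u i < n" "w (p i) < n"
      by (simp_all only: permutes_lessThan_iff[OF u] permutes_lessThan_iff[OF w])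
    then have "A $$ (u i, w (p i)) = (if w (p i) = w (p0 i) then 1 else 0)"
      using that(2) by (simp add: A_def wp0)
    then show ?thesis using permutes_inj[OF w] by (simp add: inj_eq)
  qed
  let ?h = "\<lambda>p. signof p * (\<Prod>i = 0..<k. A $$ (u i, w (p i)))"
  have h0: "?h p = 0" if p: "p permutes {0..<k}" "p \<noteq> p0" for p
  proof -
    obtain i where i: "p i \<noteq> p0 i" using p(2) by blast
    then have "i < k"
      using permutes_not_in[OF p(1), of i] permutes_not_in[OF p0, of i] by (cases "i < k") auto
    then have "(\<Prod>i = 0..<k. A $$ (u i, w (p i))) = 0"
      using entry[OF p(1)] i by (intro prod_zero) auto
    then show ?thesis by simp
  qed
  have "minor k u w A = ?h p0 + (\<Sum>p\<in>{p. p permutes {0..<k}} - {p0}. ?h p)"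
    unfolding minor_expand using p0 by (intro sum.remove) (simp_all add: finite_permutations)
  also have "(\<Sum>p\<in>{p. p permutes {0..<k}} - {p0}. ?h p) = 0"
    by (intro sum.neutral ballI h0) auto
  finally have "minor k u w A = ?h p0" by simp
  moreover have "(\<Prod>i = 0..<k. A $$ (u i, w (p0 i))) = 1"
    using entry[OF p0] by (intro prod.neutral) auto
  ultimately have "minor k u w A \<noteq> 0" by (simp add: sign_def)
  then show ?thesis
    using \<open>upper_triangular A\<close> by (intro bexI[of _ A]) (auto simp: A_def)
qed

lemma flag_minor_mult_perm_mat:
  assumes "g \<in> carrier_mat n n" "w permutes {..<n}" "k \<le> n" "f ` {..<k} \<subseteq> {..<n}"
  shows "flag_minor k f (g * perm_mat n w) = minor k f w g"
  unfolding minor_def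
  by (rule arg_cong[of _ _ det], rule cong_mat)
    (use assms in \<open>auto simp: index_mult_perm_mat simp del: index_mult_mat(1)\<close>)

lemma permutes_image_subset: "u permutes {..<n} \<Longrightarrow> k \<le> n \<Longrightarrow> u ` {..<k} \<subseteq> {..<(n::nat)}"
  by (auto simp: permutes_lessThan_iff)

text \<open>Finitely many nonvanishing conditions, each satisfiable by some upper triangular matrix,
  hold simultaneously for a suitable one. The product of the diagonal entries joins the list to make
  that matrix invertible.\<close>

lemma exists_borel_minors_nonzero:
  assumes u: "u permutes {..<n}" and w: "w permutes {..<n}" and le: "tableau_le n u w"
  shows "\<exists>b\<in>borel_subgroup n. \<forall>k\<le>n. flag_minor k u (b * perm_mat n w) \<noteq> 0"
proof -
  define P where "P = insert (\<lambda>g. \<Prod>i<n. g $$ (i, i)) ((\<lambda>k. minor k u w) ` {..n} :: (complex mat \<Rightarrow>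
    complex) set)"
  have "\<exists>A\<in>carrier_mat n n. upper_triangular A \<and> (\<forall>p\<in>P. p A \<noteq> 0)"
  proof (rule upper_triangular_common_nonzero)
    show "finite P" by (simp add: P_def)
    have "minor k u w \<in> poly_fun n" if "k \<le> n" for k
      using permutes_image_subset[OF u that] permutes_image_subset[OF w that]
        by (rule poly_fun_minor)
    then show "P \<subseteq> poly_fun n"
      unfolding P_def by (auto intro!: poly_fun_prod poly_fun.entry)
    fix p assume "p \<in> P"
    then consider "p = (\<lambda>g. \<Prod>i<n. g $$ (i, i))" | k where "k \<le> n" "p = minor k u w"
      by (auto simp: P_def)
    then show "\<exists>A\<in>carrier_mat n n. upper_triangular A \<and> p A \<noteq> 0"
    proof cases
      case 1
      then show ?thesis by (intro bexI[of _ "1\<^sub>m n"]) (auto simp: upper_triangular_def)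
    next
      case 2
      then show ?thesis
        using exists_upper_triangular_minor_nonzero[OF u w] le by (simp add: tableau_le_def)
    qed
  qed
  then obtain b where b: "b \<in> carrier_mat n n" "upper_triangular b" and nz: "\<forall>p\<in>P. p b \<noteq> 0" by blast
  have "\<forall>i<n. b $$ (i, i) \<noteq> 0" using nz by (simp add: P_def)
  then have "b \<in> borel_subgroup n" using b by (simp add: borel_iff)
  moreover have "flag_minor k u (b * perm_mat n w) \<noteq> 0" if "k \<le> n" for k
    using nz that flag_minor_mult_perm_mat[OF b(1) w that permutes_image_subset[OF u that]]
    by (simp add: P_def)
  ultimately show ?thesis by blast
qed

lemma flag_minor_update_nonzero:
  assumes "u permutes {..<n}" "flag_minor (Suc k) (u(k := i)) g \<noteq> 0"
  shows "i \<notin> u ` {..<k}"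
proof
  assume "i \<in> u ` {..<k}"
  then obtain j where j: "j < k" "i = u j" by auto
  then have "flag_minor (Suc k) (u(k := i)) g = 0" by (intro minor_eq_0[of j k]) auto
  with assms show False by simp
qed

text \<open>Start from a point of the Schubert cell at which all flag minors of \<open>u\<close> are
  nonzero. The one-parameter curve with exponents \<open>perm_inv u\<close> moves it to
  \<open>u B\<close> as \<open>s\<close> tends to 0, and stays in the cell because the torus lies in
  \<open>B\<close>.\<close>

lemma perm_coset_in_schubert_variety:
  assumes u: "u permutes {..<n}" and w: "w permutes {..<n}" and le: "tableau_le n u w"
  shows "coset n (perm_mat n u) \<in> schubert_variety n w"
proof -
  obtain b where b: "b \<in> borel_subgroup n" and nz: "\<And>k. k \<le> n \<Longrightarrow> flag_minor k u (b * perm_mat n w)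
    \<noteq> 0"
    using exists_borel_minors_nonzero[OF u w le] by blast
  define g where "g = b * perm_mat n w"
  define T where "T s = dmat n (\<lambda>i. complex_of_real (s powr real (perm_inv u i)))" for s :: real
  have g: "g \<in> GL n" unfolding g_def by (rule GL_mult[OF borel_GL[OF b] perm_mat_GL[OF w]])
  \<comment> \<open>A nonzero minor has no repeated row, so \<open>i\<close> is not among
    \<open>u 0, ..., u (k - 1)\<close> and comes after \<open>u k\<close> in
    \<open>u\<close>.\<close>
  have "real (perm_inv u (u k)) < real (perm_inv u i)"
    if "k < n" "i < n" "i \<noteq> u k" "flag_minor (Suc k) (u(k := i)) g \<noteq> 0" for k i
  proof -
    have "k \<le> perm_inv u i"
      using flag_minor_update_nonzero[OF u that(4)] permutes_notin_image_lessThan[OF u] by simp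
    moreover have "k \<noteq> perm_inv u i" using that(3) by (auto simp: permutes_inverses(1)[OF u])
    ultimately show ?thesis by (simp add: permutes_inverses(2)[OF u])
  qed
  from torus_limit_perm_mat[where a = "\<lambda>i. real (perm_inv u i)", OF u g nz[folded g_def] this]
  obtain G where G: "\<forall>s>0. G s \<in> GL n" "\<forall>s>0. coset n (G s) = coset n (T s * g)"
    and lim: "\<forall>i<n. \<forall>j<n. ((\<lambda>s. G s $$ (i, j)) \<longlongrightarrow> perm_mat n u $$ (i, j)) (at_right 0)"
    unfolding T_def by blast
  show ?thesis
    unfolding schubert_variety_def in_closure_of
  proof (intro conjI allI impI)
    show "coset n (perm_mat n u) \<in> topspace (flag_topology n)"
      by (simp add: coset_in_flag_variety perm_mat_GL[OF u])
    fix U assume U: "coset n (perm_mat n u) \<in> U \<and> openin (flag_topology n) U"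
    then have "\<forall>\<^sub>F s in at_right 0. coset n (G s) \<in> U"
      by (intro eventually_coset_in_open[OF _ _ perm_mat_GL[OF u] G(1) lim]) auto
    moreover have "\<forall>\<^sub>F s in at_right 0. (0::real) < s" by (rule eventually_at_right_less)
    ultimately have "\<forall>\<^sub>F s in at_right 0. 0 < s \<and> coset n (G s) \<in> U" by eventually_elim simp
    then obtain s :: real where s: "0 < s" "coset n (G s) \<in> U"
      using eventually_happens'[OF trivial_limit_at_right_real] by blast
    have T: "T s \<in> borel_subgroup n" unfolding T_def using s by (intro dmat_borel) simp
    have "T s * g = (T s * b) * perm_mat n w"
      unfolding g_def using borel_carrier[OF T] borel_carrier[OF b]
        by (simp add: assoc_mult_mat[of _ n n _ n _ n])
    then have "coset n (G s) = coset n ((T s * b) * perm_mat n w)" using G(2) s by simp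
    then show "\<exists>y. y \<in> (\<lambda>b. coset n (b * perm_mat n w)) ` borel_subgroup n \<and> y \<in> U"
      using s(2) borel_mult[OF T b] by (intro exI[of _ "coset n (G s)"]) auto
  qed
qed

section \<open>Vanishing of minors on Schubert varieties\<close>

text \<open>A nonzero term of the Leibniz expansion matches row \<open>f i\<close> with column
  \<open>w (p i)\<close>, and upper triangularity gives \<open>f i \<le> w (p i)\<close>. The
  matching is the required bijection.\<close>

lemma minor_upper_triangular_nonzero_imp:
  assumes b: "b \<in> carrier_mat n n" "upper_triangular b" and w: "w permutes {..<n}"
    and k: "k \<le> n" and f: "f ` {..<k} \<subseteq> {..<n}" and nz: "minor k f w b \<noteq> 0"
  shows "tuple_le (f ` {..<k}) (w ` {..<k})"
proof -
  obtain p where p: "p permutes {0..<k}" "(\<Prod>i = 0..<k. b $$ (f i, w (p i))) \<noteq> 0"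
    using nz unfolding minor_expand
      by (metis (mono_tags, lifting) mem_Collect_eq mult_zero_right sum.neutral)
  have inj: "inj_on f {..<k}" using nz by (rule minor_nonzero_imp_inj_on)
  have le: "f i \<le> w (p i)" if i: "i < k" for i
  proof (rule ccontr)
    assume "\<not> f i \<le> w (p i)"
    then have "b $$ (f i, w (p i)) = 0" using b f i by (auto simp: upper_triangular_def)
    then have "(\<Prod>i = 0..<k. b $$ (f i, w (p i))) = 0" using i by (intro prod_zero) auto
    with p(2) show False by simp
  qed
  define \<phi> where "\<phi> = w \<circ> p \<circ> inv_into {..<k} f"
  have "bij_betw (inv_into {..<k} f) (f ` {..<k}) {..<k}"
    using inj by (simp add: bij_betw_inv_into inj_on_imp_bij_betw)
  moreover have "bij_betw p {..<k} {..<k}"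
    using permutes_imp_bij[OF p(1)] by (simp add: atLeast0LessThan)
  moreover have "bij_betw w {..<k} (w ` {..<k})"
    using inj_on_subset[OF permutes_inj[OF w]] by (simp add: inj_on_imp_bij_betw)
  ultimately have bij: "bij_betw \<phi> (f ` {..<k}) (w ` {..<k})"
    unfolding \<phi>_def comp_assoc by (blast intro: bij_betw_trans)
  show ?thesis
  proof (rule tuple_leI_bij[OF _ bij])
    fix x assume "x \<in> f ` {..<k}"
    then obtain i where "i < k" "x = f i" by auto
    then show "x \<le> \<phi> x" using le inj by (simp add: \<phi>_def)
  qed simp
qed

lemma schubert_variety_minor_nonzero_imp:
  assumes w: "w permutes {..<n}" and g: "g \<in> GL n" and mem: "coset n g \<in> schubert_variety n w"
    and k: "k \<le> n" and f: "f ` {..<k} \<subseteq> {..<n}" and nz: "flag_minor k f g \<noteq> 0"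
  shows "tuple_le (f ` {..<k}) (w ` {..<k})"
proof -
  obtain b where b: "b \<in> borel_subgroup n" and chart: "coset n (b * perm_mat n w) \<in> minor_chart n
    k f"
    using closure_of_minor_nonzero[OF mem[unfolded schubert_variety_def] g k f nz] by blast
  have "b * perm_mat n w \<in> GL n" by (rule GL_mult[OF borel_GL[OF b] perm_mat_GL[OF w]])
  then have "flag_minor k f (b * perm_mat n w) \<noteq> 0"
    using chart by (simp add: coset_in_minor_chart_iff[OF _ k f])
  then have "minor k f w b \<noteq> 0"
    using flag_minor_mult_perm_mat[OF borel_carrier[OF b] w k f] by simp
  then show ?thesis
    using b by (intro minor_upper_triangular_nonzero_imp[OF _ _ w k f]) (auto simp: borel_iff)
qed

section \<open>The cone at a fixed point\<close>

text \<open>The cone before projection, so that cones can be compared inside the full space of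
  exponent vectors.\<close>

definition dual_cone :: "nat \<Rightarrow> complex mat set \<Rightarrow> complex mat set \<Rightarrow> real vec set" where
  "dual_cone n y x = {a \<in> carrier_vec n. \<forall>m\<in>carrier_vec n. char_regular_at n y m x \<longrightarrow>
     0 \<le> map_vec real_of_int m \<bullet> a}"

lemma orbit_cone_eq: "orbit_cone n y x = quot_proj (fixing_space n (orbit_closure n y)) `
  dual_cone n y x"
  by (simp add: orbit_cone_def dual_cone_def)

text \<open>The root \<open>e_i - e_j\<close> of the general linear group, or 0 if
  \<open>i = j\<close>.\<close>

definition char_diff :: "nat \<Rightarrow> nat \<Rightarrow> nat \<Rightarrow> int vec" where
  "char_diff n i j = vec n (\<lambda>l. (if l = i then 1 else 0) - (if l = j then 1 else 0))"

lemma char_diff_carrier [simp]: "char_diff n i j \<in> carrier_vec n"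
  by (simp add: char_diff_def)

lemma torus_char_char_diff:
  assumes d: "\<And>l. l < n \<Longrightarrow> d l \<noteq> 0" and ij: "i < n" "j < n"
  shows "torus_char n (char_diff n i j) (dmat n d) = d i / d j"
proof -
  have "torus_char n (char_diff n i j) (dmat n d) =
      (\<Prod>l<n. (if l = i then d l else 1) / (if l = j then d l else 1))"
    unfolding torus_char_def char_diff_def
    by (intro prod.cong refl) (use d in \<open>auto simp: power_int_diff power_int_minus field_simps\<close>)
  also have "\<dots> = d i / d j" using ij by (simp add: prod_dividef)
  finally show ?thesis .
qed

lemma char_diff_scalar_prod:
  assumes a: "a \<in> carrier_vec n" and ij: "i < n" "j < n"
  shows "map_vec real_of_int (char_diff n i j) \<bullet> a = a $ i - a $ j"
proof -
  have "map_vec real_of_int (char_diff n i j) \<bullet> a =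
      (\<Sum>l<n. (if l = i then a $ l else 0) - (if l = j then a $ l else 0))"
    using a by (simp add: scalar_prod_def char_diff_def atLeast0LessThan) (intro sum.cong, auto)
  also have "\<dots> = a $ i - a $ j" using ij by (simp add: sum_subtractf)
  finally show ?thesis .
qed

text \<open>The vector \<open>vec n (($) m)\<close> has dimension \<open>n\<close> whatever the
  dimension of \<open>m\<close>, and it has the entries that \<open>torus_char\<close>
  reads.\<close>

lemma torus_char_powr:
  assumes s: "s > 0" and a: "a \<in> carrier_vec n"
  shows "torus_char n m (dmat n (\<lambda>i. complex_of_real (s powr a $ i)))
       = complex_of_real (s powr (map_vec real_of_int (vec n (($) m)) \<bullet> a))"
proof -
  have "torus_char n m (dmat n (\<lambda>i. complex_of_real (s powr a $ i))) =
      (\<Prod>i<n. complex_of_real (s powr (real_of_int (m $ i) * a $ i)))"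
    unfolding torus_char_def
  proof (intro prod.cong refl)
    fix i assume "i \<in> {..<n}"
    have "(s powr a $ i) powi (m $ i) = s powr (real_of_int (m $ i) * a $ i)"
      using s by (simp add: powr_real_of_int'[symmetric] powr_powr mult.commute)
    then have "complex_of_real (s powr a $ i) powi (m $ i) =
      complex_of_real (s powr (real_of_int (m $ i) * a $ i))"
      by (metis of_real_power_int)
    with \<open>i \<in> {..<n}\<close> show "dmat n (\<lambda>i. complex_of_real (s powr a $ i)) $$ (i, i) powi (m $ i) =
        complex_of_real (s powr (real_of_int (m $ i) * a $ i))" by simp
  qed
  also have "\<dots> = complex_of_real (s powr (\<Sum>i<n. real_of_int (m $ i) * a $ i))"
    using s by (simp add: powr_sum)
  also have "(\<Sum>i<n. real_of_int (m $ i) * a $ i) = map_vec real_of_int (vec n (($) m)) \<bullet> a"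
    using a by (simp add: scalar_prod_def atLeast0LessThan)
  finally show ?thesis .
qed

lemma prod_fun_upd_lessThan_Suc: "(\<Prod>r<Suc k. d ((u(k := i)) r)) = (\<Prod>r<k. d (u r)) * d i"
proof -
  have "(\<Prod>r<k. d ((u(k := i)) r)) = (\<Prod>r<k. d (u r))" by (intro prod.cong) auto
  then show ?thesis by simp
qed

lemma fun_upd_image_subset:
  assumes "u permutes {..<n}" "k < n" "i < n"
  shows "(u(k := i)) ` {..<Suc k} \<subseteq> {..<n}"
proof
  fix x assume "x \<in> (u(k := i)) ` {..<Suc k}"
  then obtain r where "r \<in> {..<Suc k}" "x = (u(k := i)) r" by blast
  with assms show "x \<in> {..<n}" by (cases "r = k") (simp_all add: permutes_lessThan_iff[OF assms(1)])
qed

section \<open>Flags in a generic torus orbit\<close>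

text \<open>The two consequences of genericity on which the cone computation rests, for one
  representative \<open>g\<close>: membership in the Schubert variety bounds the rows of nonzero
  minors, and the orbit closure reaches the fixed points below \<open>w\<close>.\<close>

locale generic_flag =
  fixes n :: nat and w :: "nat \<Rightarrow> nat" and g :: "complex mat"
  assumes w: "w permutes {..<n}" and g: "g \<in> GL n"
    and minor_nonzero_imp: "\<And>k f. k \<le> n \<Longrightarrow> f ` {..<k} \<subseteq> {..<n} \<Longrightarrow> flag_minor k f g \<noteq> 0 \<Longrightarrow>
      tuple_le (f ` {..<k}) (w ` {..<k})"
    and perm_in_closure: "\<And>u. u permutes {..<n} \<Longrightarrow> tableau_le n u w \<Longrightarrow>
      coset n (perm_mat n u) \<in> orbit_closure n (coset n g)"
begin

lemma g_carrier: "g \<in> carrier_mat n n"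
  using g by (simp add: GL_iff)

lemma torus_orbit_iff:
  "x \<in> torus_orbit n (coset n g) \<longleftrightarrow> (\<exists>d. (\<forall>i<n. d i \<noteq> 0) \<and> x = coset n (dmat n d * g))"
proof
  assume "x \<in> torus_orbit n (coset n g)"
  then obtain t where t: "t \<in> torus n" "x = act t (coset n g)" by (auto simp: torus_orbit_def)
  then show "\<exists>d. (\<forall>i<n. d i \<noteq> 0) \<and> x = coset n (dmat n d * g)"
    using torus_imp_dmat[OF t(1)] by (auto simp: act_coset[OF _ g_carrier])
next
  assume "\<exists>d. (\<forall>i<n. d i \<noteq> 0) \<and> x = coset n (dmat n d * g)"
  then obtain d where d: "\<forall>i<n. d i \<noteq> 0" "x = coset n (dmat n d * g)" by blast
  then have "dmat n d \<in> torus n" by (intro dmat_torus) simp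
  then show "x \<in> torus_orbit n (coset n g)"
    unfolding torus_orbit_def
    by (rule image_eqI[rotated]) (simp add: d(2) act_coset[OF dmat_carrier g_carrier])
qed

lemma dmat_g_GL: "\<forall>i<n. d i \<noteq> 0 \<Longrightarrow> dmat n d * g \<in> GL n"
  by (rule GL_mult[OF torus_GL[OF dmat_torus] g]) simp

lemma orbit_subset_closure: "torus_orbit n (coset n g) \<subseteq> orbit_closure n (coset n g)"
  unfolding orbit_closure_def
  by (rule closure_of_subset) (auto simp: torus_orbit_iff dmat_g_GL coset_in_flag_variety)

lemma closure_flag_variety: "x \<in> orbit_closure n (coset n g) \<Longrightarrow> x \<in> flag_variety n"
  by (simp add: orbit_closure_def in_closure_of)

text \<open>A minor that is nonzero at a limit is nonzero at some orbit point, and the torus only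
  rescales minors by nonzero factors.\<close>

lemma flag_minor_nonzero_of_closure:
  assumes h: "h \<in> GL n" "coset n h \<in> orbit_closure n (coset n g)"
    and k: "k \<le> n" and f: "f ` {..<k} \<subseteq> {..<n}" and nz: "flag_minor k f h \<noteq> 0"
  shows "flag_minor k f g \<noteq> 0"
proof -
  obtain x where x: "x \<in> torus_orbit n (coset n g)" "x \<in> minor_chart n k f"
    using closure_of_minor_nonzero[OF h(2)[unfolded orbit_closure_def] h(1) k f nz] by blast
  then obtain d where d: "\<forall>i<n. d i \<noteq> 0" "x = coset n (dmat n d * g)"
    by (auto simp: torus_orbit_iff)
  then have "flag_minor k f (dmat n d * g) \<noteq> 0"
    using x(2) by (simp add: coset_in_minor_chart_iff[OF dmat_g_GL k f])
  then show ?thesis by (auto simp: minor_dmat_mult[OF g_carrier f k])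
qed

text \<open>The point \<open>u B\<close> lies in the orbit closure, and there the minor is
  1.\<close>

lemma perm_minor_nonzero:
  assumes u: "u permutes {..<n}" and le: "tableau_le n u w" and k: "k \<le> n"
  shows "flag_minor k u g \<noteq> 0"
  by (rule flag_minor_nonzero_of_closure[OF perm_mat_GL[OF u] perm_in_closure[OF u le] k
    permutes_image_subset[OF u k]])
    (simp add: flag_minor_perm_mat[OF u k])

lemma admissible_minor_nonzero:
  assumes u: "u permutes {..<n}" and le: "tableau_le n u w" and adm: "admissible n w u k i"
  shows "flag_minor (Suc k) (u(k := i)) g \<noteq> 0"
proof -
  obtain u' where u': "u' permutes {..<n}" "tableau_le n u' w" "\<forall>j\<le>k. u' j = (u(k := i)) j"
    using admissible_extend[OF w u le adm] by blast
  have "flag_minor (Suc k) (u(k := i)) g = flag_minor (Suc k) u' g"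
    using u'(3) by (intro minor_cong) simp
  then show ?thesis
    using perm_minor_nonzero[OF u'(1,2), of "Suc k"] adm by (simp add: admissible_def)
qed

text \<open>With \<open>admissible_minor_nonzero\<close>, this identifies the admissible pairs for
  \<open>u\<close> below \<open>w\<close> with the nonzero bordered minors of
  \<open>g\<close>.\<close>

lemma minor_nonzero_admissible:
  assumes u: "u permutes {..<n}" and ki: "k < n" "i < n" and nz: "flag_minor (Suc k) (u(k :=
    i)) g \<noteq> 0"
  shows "admissible n w u k i"
proof -
  have "(u(k := i)) ` {..<k} = u ` {..<k}" by (intro image_cong) auto
  then have "(u(k := i)) ` {..<Suc k} = insert i (u ` {..<k})" unfolding lessThan_Suc_image by simp
  then show ?thesis
    using minor_nonzero_imp[OF _ fun_upd_image_subset[OF u ki] nz] ki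
      flag_minor_update_nonzero[OF u nz] by (simp add: admissible_def)
qed

section \<open>Regular characters and the cone at a fixed point\<close>

text \<open>The quotient of the minors with row sets \<open>u ` {..<k} \<union> {i}\<close> and \<open>u ` {..k}\<close>, scaled to be
  \<open>1\<close> at the base point, is the regular function extending the character.\<close>

lemma char_diff_regular:
  assumes u: "u permutes {..<n}" and le: "tableau_le n u w" and adm: "admissible n w u k i"
    and z: "z \<in> orbit_closure n (coset n g)" "z \<in> minor_chart n (Suc k) u"
  shows "char_regular_at n (coset n g) (char_diff n i (u k)) z"
proof -
  have ki: "k < n" "i < n" using adm by (auto simp: admissible_def)
  define f where "f = u(k := i)"
  have f: "f ` {..<Suc k} \<subseteq> {..<n}" unfolding f_def by (rule fun_upd_image_subset[OF u ki])
  have k: "Suc k \<le> n" using ki by simp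
  have ui: "u ` {..<Suc k} \<subseteq> {..<n}" by (rule permutes_image_subset[OF u k])
  have nz: "flag_minor (Suc k) f g \<noteq> 0" "flag_minor (Suc k) u g \<noteq> 0"
    unfolding f_def using admissible_minor_nonzero[OF u le adm] perm_minor_nonzero[OF u le k]
      by auto
  define p where "p = (\<lambda>h. (flag_minor (Suc k) u g / flag_minor (Suc k) f g) * flag_minor (Suc k)
    f h)"
  define q where "q = (\<lambda>h :: complex mat. flag_minor (Suc k) u h)"
  have pq: "p \<in> poly_fun n" "q \<in> poly_fun n"
  proof -
    have "flag_minor (Suc k) f \<in> poly_fun n" "flag_minor (Suc k) u \<in> poly_fun n"
      using f ui k by (auto intro!: poly_fun_minor)
    then show "p \<in> poly_fun n" "q \<in> poly_fun n"
      unfolding p_def q_def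
        by (auto intro: poly_fun.mult[OF poly_fun.const] simp del: times_divide_eq_left)
  qed
  \<comment> \<open>The chosen representative does not affect the value: along a coset, numerator
    and denominator scale by the same factor.\<close>
  define H where "H x = (let h = SOME h. h \<in> x in p h / q h)" for x
  have H: "H (coset n h) = p h' / q h'" if h: "h \<in> GL n" "h' \<in> coset n h" for h h'
  proof -
    have hc: "h \<in> carrier_mat n n" using h by (simp add: GL_iff)
    have *: "p h'' / q h'' = p h / q h" if h'': "h'' \<in> coset n h" for h''
    proof -
      obtain c where "c \<noteq> 0" "flag_minor (Suc k) f h'' = flag_minor (Suc k) f h * c"
        "flag_minor (Suc k) u h'' = flag_minor (Suc k) u h * c"
        using flag_minor_coset[OF hc h'' k] f ui by blast
      then show ?thesis by (simp add: p_def q_def)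
    qed
    have "(SOME h''. h'' \<in> coset n h) \<in> coset n h" using h(2) by (auto simp: some_in_eq)
    then show ?thesis using *[OF h(2)] * by (simp add: H_def Let_def)
  qed
  define V where "V = minor_chart n (Suc k) u \<inter> orbit_closure n (coset n g)"
  have V_open: "openin (subtopology (flag_topology n) (orbit_closure n (coset n g))) V"
    unfolding V_def openin_subtopology using openin_minor_chart[OF k ui] by blast
  have "regular_on n V H"
    unfolding regular_on_def
  proof
    fix x assume x: "x \<in> V"
    have "openin (subtopology (flag_topology n) V) V"
      unfolding openin_subtopology using openin_minor_chart[OF k ui] V_def by blast
    moreover have "\<forall>v\<in>V. \<forall>h\<in>v. q h \<noteq> 0 \<and> H v = p h / q h"
    proof (intro ballI conjI)
      fix v h assume v: "v \<in> V" "h \<in> v"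
      show "q h \<noteq> 0" using v by (auto simp: q_def V_def minor_chart_def)
      have "v \<in> flag_variety n" using v by (simp add: V_def minor_chart_def)
      then obtain h0 where "h0 \<in> GL n" "v = coset n h0" by (auto simp: flag_variety_def)
      then show "H v = p h / q h" using H v(2) by blast
    qed
    ultimately show "\<exists>V' p q. openin (subtopology (flag_topology n) V) V' \<and> x \<in> V' \<and>
        p \<in> poly_fun n \<and> q \<in> poly_fun n \<and> (\<forall>z\<in>V'. \<forall>g\<in>z. q g \<noteq> 0 \<and> H z = p g / q g)"
      using x pq by (intro exI[of _ V] exI[of _ p] exI[of _ q] conjI)
  qed
  moreover have "H (act t (coset n g)) = torus_char n (char_diff n i (u k)) t"
    if t: "t \<in> torus n" for t
  proof -
    obtain d where d: "\<forall>i<n. d i \<noteq> 0" "t = dmat n d" using torus_imp_dmat[OF t] by blast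
    have P: "(\<Prod>r<k. d (u r)) \<noteq> 0" using d ki by (auto simp: permutes_lessThan_iff[OF u])
    have "H (act t (coset n g)) = p (dmat n d * g) / q (dmat n d * g)"
      unfolding d(2) act_coset[OF dmat_carrier g_carrier]
      by (rule H[OF dmat_g_GL[OF d(1)] coset_self]) (use g_carrier in auto)
    \<comment> \<open>The minors contribute the weights of their rows, and the scaling constant in
      \<open>p\<close> cancels the minors of \<open>g\<close>. The two row lists differ only in the
      entry at \<open>k\<close>.\<close>
    also have "\<dots> = ((\<Prod>r<Suc k. d (f r)) / (\<Prod>r<Suc k. d (u r)))"
      using nz by (simp add: p_def q_def minor_dmat_mult[OF g_carrier f k] minor_dmat_mult[OF
        g_carrier ui k] del: prod.lessThan_Suc)
    also have "\<dots> = d i / d (u k)"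
      unfolding f_def prod_fun_upd_lessThan_Suc using P by simp
    also have "\<dots> = torus_char n (char_diff n i (u k)) t"
      unfolding d(2) using d(1) ki
        by (intro torus_char_char_diff[symmetric]) (auto simp: permutes_lessThan_iff[OF u])
    finally show ?thesis .
  qed
  moreover have "z \<in> V" using z by (simp add: V_def)
  ultimately show ?thesis unfolding char_regular_at_def using V_open by blast
qed

text \<open>Every point in the charts of \<open>u\<close> is covered, not just \<open>u B\<close>,
  because the maximality proof must bound the cones at other points of the closure.\<close>

lemma dual_cone_subset:
  assumes u: "u permutes {..<n}" and le: "tableau_le n u w"
    and z: "z \<in> orbit_closure n (coset n g)" "\<And>k. k \<le> n \<Longrightarrow> z \<in> minor_chart n k u"
  shows "dual_cone n (coset n g) z \<subseteq> fixed_point_cone n w u"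
proof
  fix a assume a: "a \<in> dual_cone n (coset n g) z"
  then have ac: "a \<in> carrier_vec n" by (simp add: dual_cone_def)
  have "a $ u k \<le> a $ i" if adm: "admissible n w u k i" for k i
  proof -
    have ki: "k < n" "i < n" using adm by (auto simp: admissible_def)
    have "char_regular_at n (coset n g) (char_diff n i (u k)) z"
      by (rule char_diff_regular[OF u le adm z(1) z(2)]) (use ki in simp)
    then have "0 \<le> map_vec real_of_int (char_diff n i (u k)) \<bullet> a" using a
      by (simp add: dual_cone_def)
    then show ?thesis using ki
      by (simp add: char_diff_scalar_prod[OF ac] permutes_lessThan_iff[OF u])
  qed
  with ac show "a \<in> fixed_point_cone n w u" by (simp add: fixed_point_cone_def)
qed

text \<open>A character that is regular at \<open>u B\<close> stays bounded along the curve \<open>s \<mapsto> s\<^sup>a y\<close>, which tends to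
  \<open>u B\<close> as \<open>s \<rightarrow> 0\<close>.\<close>

lemma char_regular_strict_nonneg:
  assumes u: "u permutes {..<n}" and le: "tableau_le n u w"
    and m: "m \<in> carrier_vec n" "char_regular_at n (coset n g) m (coset n (perm_mat n u))"
    and a: "a \<in> carrier_vec n" "\<And>k i. admissible n w u k i \<Longrightarrow> i \<noteq> u k \<Longrightarrow> a $ u k < a $ i"
  shows "0 \<le> map_vec real_of_int m \<bullet> a"
proof (rule ccontr)
  define c where "c = map_vec real_of_int m \<bullet> a"
  assume "\<not> ?thesis"
  then have c: "c < 0" by (simp add: c_def)
  define A where "A = perm_mat n u"
  have A: "A \<in> GL n" unfolding A_def by (rule perm_mat_GL[OF u])
  obtain V h where V: "openin (subtopology (flag_topology n) (orbit_closure n (coset n g))) V"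
    "coset n A \<in> V"
    and reg: "regular_on n V h" and h: "\<And>t. t \<in> torus n \<Longrightarrow> act t (coset n g) \<in> V \<Longrightarrow>
      h (act t (coset n g)) = torus_char n m t"
    using m(2) unfolding char_regular_at_def A_def by blast
  obtain V' p q where V': "openin (subtopology (flag_topology n) V) V'" "coset n A \<in> V'"
    and pq: "p \<in> poly_fun n" "q \<in> poly_fun n"
    and hpq: "\<forall>z\<in>V'. \<forall>x\<in>z. q x \<noteq> 0 \<and> h z = p x / q x"
    using bspec[OF reg[unfolded regular_on_def] V(2)] by (elim exE conjE) (rule that)
  obtain U where U: "openin (flag_topology n) U" "V = U \<inter> orbit_closure n (coset n g)"
    using V(1) unfolding openin_subtopology by blast
  obtain U' where U': "openin (flag_topology n) U'" "V' = U' \<inter> V"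
    using V'(1) unfolding openin_subtopology by blast
  define T where "T s = dmat n (\<lambda>i. complex_of_real (s powr a $ i))" for s
  \<comment> \<open>Nonzero bordered minors come from admissible pairs, so strictness of
    \<open>a\<close> on those pairs is what the limit lemma asks for.\<close>
  have "a $ u k < a $ i" if "k < n" "i < n" "i \<noteq> u k" "flag_minor (Suc k) (u(k := i)) g \<noteq> 0" for k i
    using a(2) minor_nonzero_admissible[OF u that(1,2,4)] that(3) by blast
  from torus_limit_perm_mat[where a = "\<lambda>i. a $ i", OF u g perm_minor_nonzero[OF u le] this]
  obtain G where G: "\<forall>s>0. G s \<in> GL n" "\<forall>s>0. coset n (G s) = coset n (T s * g)"
    and lim: "\<forall>i<n. \<forall>j<n. ((\<lambda>s. G s $$ (i, j)) \<longlongrightarrow> A $$ (i, j)) (at_right 0)"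
    unfolding T_def A_def by blast
  have "\<forall>\<^sub>F s in at_right 0. coset n (G s) \<in> U \<inter> U'"
    by (rule eventually_coset_in_open[OF _ _ A G(1) lim]) (use U U' V(2) V'(2) in auto)
  moreover have "\<forall>\<^sub>F s in at_right 0. (0::real) < s" by (rule eventually_at_right_less)
  ultimately have ev: "\<forall>\<^sub>F s in at_right 0. p (G s) / q (G s) = complex_of_real (s powr c)"
  proof eventually_elim
    case (elim s)
    have T: "T s \<in> torus n" unfolding T_def using elim by (intro dmat_torus) simp
    have Tc: "T s \<in> carrier_mat n n" by (simp add: T_def)
    have eq: "coset n (G s) = act (T s) (coset n g)"
      using G(2) elim act_coset[OF Tc g_carrier] by simp
    have "act (T s) (coset n g) \<in> orbit_closure n (coset n g)"
      using orbit_subset_closure T by (auto simp: torus_orbit_def)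
    then have V'mem: "coset n (G s) \<in> V" "coset n (G s) \<in> V'" using elim U(2) U'(2) eq by auto
    have "G s \<in> coset n (G s)" using G(1) elim by (intro coset_self) (simp add: GL_iff)
    then have "p (G s) / q (G s) = h (coset n (G s))"
      using bspec[OF bspec[OF hpq V'mem(2)], of "G s"] by simp
    also have "\<dots> = torus_char n m (T s)" using h[OF T] V'mem(1) eq by simp
    also have "\<dots> = complex_of_real (s powr (map_vec real_of_int (vec n (($) m)) \<bullet> a))"
      unfolding T_def using elim a(1) by (intro torus_char_powr) auto
    also have "vec n (($) m) = m" using m(1) by (intro eq_vecI) auto
    finally show ?case by (simp add: c_def)
  qed
  have "q A \<noteq> 0" using hpq V'(2) coset_self[of A n] A unfolding GL_iff by blast
  then have "((\<lambda>s. p (G s) / q (G s)) \<longlongrightarrow> p A / q A) (at_right 0)"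
    using lim by (intro tendsto_divide poly_fun_tendsto[OF pq(1)] poly_fun_tendsto[OF pq(2)]) auto
  then have "((\<lambda>s. complex_of_real (s powr c)) \<longlongrightarrow> p A / q A) (at_right 0)"
    using ev by (rule Lim_transform_eventually)
  \<comment> \<open>Since \<open>c < 0\<close>, the factor \<open>s powr - c\<close> tends to 0
    while \<open>s powr c\<close> has a finite limit; yet their product is constantly 1.\<close>
  moreover have "((\<lambda>s. complex_of_real (s powr - c)) \<longlongrightarrow> complex_of_real 0) (at_right 0)"
    using c by (intro tendsto_of_real tendsto_zero_powrI[where b =
      "- c"] tendsto_ident_at tendsto_const
      eventually_at_right_less[THEN eventually_mono]) simp_all
  ultimately have "((\<lambda>s. complex_of_real (s powr c) * complex_of_real (s powr - c)) \<longlongrightarrow> p A / q A *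
    complex_of_real 0) (at_right 0)"
    by (rule tendsto_mult)
  moreover have "\<forall>\<^sub>F s in at_right 0. complex_of_real (s powr c) * complex_of_real (s powr - c) = 1"
    by (rule eventually_at_right_less[THEN eventually_mono]) (simp flip: of_real_mult powr_add)
  ultimately have "((\<lambda>s. 1) \<longlongrightarrow> p A / q A * complex_of_real 0) (at_right (0::real))"
    by (rule Lim_transform_eventually)
  then have "(1::complex) = p A / q A * complex_of_real 0"
    using tendsto_unique[OF trivial_limit_at_right_real tendsto_const] by blast
  then show False by simp
qed

text \<open>Adding a small positive multiple of \<open>\<rho>\<close> makes the inequalities of
  \<open>a\<close> strict, so the strict case applies; the multiple can be taken arbitrarily
  small.\<close>

lemma fixed_point_cone_subset:
  assumes u: "u permutes {..<n}" and le: "tableau_le n u w"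
  shows "fixed_point_cone n w u \<subseteq> dual_cone n (coset n g) (coset n (perm_mat n u))"
proof
  fix a assume a: "a \<in> fixed_point_cone n w u"
  then have ac: "a \<in> carrier_vec n" by (simp add: fixed_point_cone_def)
  define \<rho> where "\<rho> = vec n (\<lambda>i. real (perm_inv u i))"
  have \<rho>c: "\<rho> \<in> carrier_vec n" by (simp add: \<rho>_def)
  have "0 \<le> map_vec real_of_int m \<bullet> a"
    if m: "m \<in> carrier_vec n" "char_regular_at n (coset n g) m (coset n (perm_mat n u))" for m
  proof (rule ccontr)
    define c r where "c = map_vec real_of_int m \<bullet> a" and "r = map_vec real_of_int m \<bullet> \<rho>"
    have pos: "0 \<le> c + e * r" if e: "e > 0" for e
    proof -
      have "0 \<le> map_vec real_of_int m \<bullet> (a + e \<cdot>\<^sub>v \<rho>)"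
      proof (rule char_regular_strict_nonneg[OF u le m])
        fix k i assume adm: "admissible n w u k i" and ne: "i \<noteq> u k"
        have ki: "k < n" "i < n" "k \<le> perm_inv u i"
          using adm unfolding admissible_def permutes_notin_image_lessThan[OF u] by blast+
        have "k \<noteq> perm_inv u i" using ne by (auto simp: permutes_inverses(1)[OF u])
        then have "real k < real (perm_inv u i)" using ki by simp
        moreover have "a $ u k \<le> a $ i" using a adm by (simp add: fixed_point_cone_def)
        ultimately have "a $ u k + e * real k < a $ i + e * real (perm_inv u i)"
          using e by (intro add_le_less_mono mult_strict_left_mono)
        then show "(a + e \<cdot>\<^sub>v \<rho>) $ u k < (a + e \<cdot>\<^sub>v \<rho>) $ i"
          using ki ac by (simp add: \<rho>_def permutes_lessThan_iff[OF u] permutes_inverses(2)[OF u])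
      qed (use ac \<rho>c in auto)
      also have "\<dots> = c + e * r"
        unfolding c_def r_def using m(1) ac \<rho>c
        by (subst scalar_prod_add_distrib[of _ n]) (auto simp: scalar_prod_smult_right)
      finally show ?thesis .
    qed
    assume "\<not> 0 \<le> map_vec real_of_int m \<bullet> a"
    then have c: "c < 0" by (simp add: c_def)
    \<comment> \<open>With \<open>e = - c / (2 * R)\<close> and \<open>r \<le> R\<close>, the
      perturbed pairing \<open>c + e * r\<close> is at most \<open>c / 2 < 0\<close>.\<close>
    define R where "R = \<bar>r\<bar> + 1"
    have R: "R > 0" "r \<le> R" by (auto simp: R_def)
    define e where "e = - c / (2 * R)"
    have e: "e > 0" unfolding e_def using c R by (intro divide_pos_pos) auto
    have "e * r \<le> e * R" using e R by (intro mult_left_mono) auto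
    also have "\<dots> = - c / 2" using R by (simp add: e_def)
    finally show False using pos[OF e] c by simp
  qed
  with ac show "a \<in> dual_cone n (coset n g) (coset n (perm_mat n u))" by (simp add: dual_cone_def)
qed

lemma perm_in_minor_chart:
  assumes u: "u permutes {..<n}" and k: "k \<le> n"
  shows "coset n (perm_mat n u) \<in> minor_chart n k u"
  by (simp add: coset_in_minor_chart_iff[OF perm_mat_GL[OF u] k permutes_image_subset[OF u k]]
    flag_minor_perm_mat[OF u k])

lemma dual_cone_fixed_point:
  assumes u: "u permutes {..<n}" and le: "tableau_le n u w"
  shows "dual_cone n (coset n g) (coset n (perm_mat n u)) = fixed_point_cone n w u"
proof (rule subset_antisym)
  show "dual_cone n (coset n g) (coset n (perm_mat n u)) \<subseteq> fixed_point_cone n w u"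
    by (rule dual_cone_subset[OF u le perm_in_closure[OF u le]]) (rule perm_in_minor_chart[OF u])
qed (rule fixed_point_cone_subset[OF u le])

text \<open>Some permutation has all its flag minors nonzero at \<open>z\<close>. They are then
  nonzero at \<open>g\<close> too, and this puts the permutation below \<open>w\<close>.\<close>

lemma closure_point_charts:
  assumes z: "z \<in> orbit_closure n (coset n g)"
  shows "\<exists>u. u permutes {..<n} \<and> tableau_le n u w \<and> (\<forall>k\<le>n. z \<in> minor_chart n k u)"
proof -
  obtain h where h: "h \<in> GL n" "z = coset n h"
    using closure_flag_variety[OF z] by (auto simp: flag_variety_def)
  obtain u where u: "u permutes {..<n}" and nz: "\<forall>k\<le>n. flag_minor k u h \<noteq> 0"
    using exists_permutation_minors_nonzero[of h n] h(1) by (auto simp: GL_iff)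
  have "tuple_le (u ` {..<k}) (w ` {..<k})" if k: "k \<le> n" for k
    using nz h z k permutes_image_subset[OF u k]
    by (intro minor_nonzero_imp flag_minor_nonzero_of_closure[of h]) auto
  moreover have "z \<in> minor_chart n k u" if k: "k \<le> n" for k
    using nz k by (simp add: h(2) coset_in_minor_chart_iff[OF h(1) k permutes_image_subset[OF u k]])
  ultimately show ?thesis using u by (auto simp: tableau_le_def)
qed

section \<open>The fixing space and maximality of the cone\<close>

text \<open>A diagonal matrix that fixes \<open>g B\<close> multiplies all nonzero flag minors of
  one size by a common factor. Comparing the minors for \<open>u\<close> and
  \<open>u(k := i)\<close> isolates the two entries.\<close>

lemma one_param_fixing_eq:
  assumes u: "u permutes {..<n}" and le: "tableau_le n u w" and adm: "admissible n w u k i"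
    and fixing: "\<And>s. s \<noteq> 0 \<Longrightarrow> one_param n a s \<in> torus_fixing n (orbit_closure n (coset n g))"
  shows "a $ i = a $ u k"
proof -
  have ki: "k < n" "i < n" using adm by (auto simp: admissible_def)
  have k: "Suc k \<le> n" using ki by simp
  \<comment> \<open>Evaluation at 2 is enough, since an integer power of 2 determines its
    exponent.\<close>
  define d :: "nat \<Rightarrow> complex" where "d l = 2 powi (a $ l)" for l
  have d: "\<forall>l<n. d l \<noteq> 0" by (simp add: d_def)
  have "one_param n a 2 = dmat n d" unfolding one_param_def dmat_def d_def by (rule cong_mat) auto
  moreover have "coset n g \<in> orbit_closure n (coset n g)"
  proof -
    have "dmat n (\<lambda>_. 1) * g = g"
      by (rule eq_matI)
        (use g_carrier in \<open>auto simp: index_dmat_mult[OF g_carrier] simp del: index_mult_mat(1)\<close>)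
    then have "coset n g \<in> torus_orbit n (coset n g)"
      unfolding torus_orbit_iff by (intro exI[of _ "\<lambda>_. 1"]) simp
    then show ?thesis using orbit_subset_closure by blast
  qed
  ultimately have "act (dmat n d) (coset n g) = coset n g"
    using fixing[of 2] by (auto simp: torus_fixing_def)
  then have "dmat n d * g \<in> coset n g"
    using coset_self[OF mult_carrier_mat[OF dmat_carrier g_carrier], of d]
    by (simp add: act_coset[OF dmat_carrier g_carrier])
  then obtain c where c: "\<And>f. f ` {..<Suc k} \<subseteq> {..<n} \<Longrightarrow> flag_minor (Suc k) f (dmat n d * g) =
    flag_minor (Suc k) f g * c"
    using flag_minor_coset[OF g_carrier _ k] by blast
  have "(\<Prod>r<Suc k. d (f r)) = c" if "f ` {..<Suc k} \<subseteq> {..<n}" "flag_minor (Suc k) f g \<noteq> 0" for f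
    using c[OF that(1)] that(2)
      by (simp add: minor_dmat_mult[OF g_carrier that(1) k] del: prod.lessThan_Suc)
  from this[OF fun_upd_image_subset[OF u ki] admissible_minor_nonzero[OF u le adm]]
    this[OF permutes_image_subset[OF u k] perm_minor_nonzero[OF u le k]]
  have "(\<Prod>r<k. d (u r)) * d i = (\<Prod>r<k. d (u r)) * d (u k)"
    unfolding prod_fun_upd_lessThan_Suc by simp
  then have "d i = d (u k)" by (simp add: d_def)
  then have "norm (d i) = norm (d (u k))" by simp
  then have "(2::real) powi (a $ i) = 2 powi (a $ u k)" by (simp add: d_def norm_power_int)
  then have "(2::real) powr (a $ i) = 2 powr (a $ u k)" by (simp add: powr_real_of_int')
  then show ?thesis by (simp add: powr_inj)
qed

lemma fixing_space_zero: "0\<^sub>v n \<in> fixing_space n Y"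
proof -
  interpret vec_space "TYPE(real)" n .
  show ?thesis unfolding fixing_space_def using span_zero by (simp add: module_vec_simps)
qed

text \<open>The fixing space lies in the lineality space of the cone at each fixed point: the
  equations cut out a subspace that contains its generators.\<close>

lemma fixing_space_eq:
  assumes u: "u permutes {..<n}" and le: "tableau_le n u w"
    and b: "b \<in> fixing_space n (orbit_closure n (coset n g))"
  shows "b \<in> carrier_vec n \<and> (\<forall>k i. admissible n w u k i \<longrightarrow> b $ i = b $ u k)"
proof -
  interpret vec_module "TYPE(real)" n .
  define N :: "real vec set" where "N = {b \<in> carrier_vec n. \<forall>k i. admissible n w u k i \<longrightarrow> b $ i =
    b $ u k}"
  define S where "S = map_vec real_of_int ` {a \<in> carrier_vec n. \<forall>z. z \<noteq> 0 \<longrightarrow>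
    one_param n a z \<in> torus_fixing n (orbit_closure n (coset n g))}"
  have "S \<subseteq> N"
    using one_param_fixing_eq[OF u le]
    by (auto simp: S_def N_def admissible_def permutes_lessThan_iff[OF u])
  moreover have "submodule class_ring N V"
    unfolding submodule_def
    by (auto simp: N_def module_axioms module_vec_simps admissible_def permutes_lessThan_iff[OF u])
  ultimately have "span S \<subseteq> N" by (rule span_is_subset)
  then show ?thesis using b by (auto simp: fixing_space_def S_def N_def)
qed

text \<open>Consequently the projection identifies no point of the cone with a point outside
  it.\<close>

lemma fixed_point_cone_translate:
  assumes u: "u permutes {..<n}" and le: "tableau_le n u w"
    and a: "a \<in> fixed_point_cone n w u" and b: "b \<in> fixing_space n (orbit_closure n (coset n g))"
  shows "a + b \<in> fixed_point_cone n w u"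
proof -
  have bc: "b \<in> carrier_vec n" and ba: "\<And>k i. admissible n w u k i \<Longrightarrow> b $ i = b $ u k"
    using fixing_space_eq[OF u le b] by blast+
  have ac: "a \<in> carrier_vec n" using a by (simp add: fixed_point_cone_def)
  have "(a + b) $ u k \<le> (a + b) $ i" if adm: "admissible n w u k i" for k i
  proof -
    have "u k < n" "i < n" using adm by (auto simp: admissible_def permutes_lessThan_iff[OF u])
    moreover have "a $ u k \<le> a $ i" using a adm by (simp add: fixed_point_cone_def)
    ultimately show ?thesis using bc ba[OF adm] by simp
  qed
  then show ?thesis using ac bc by (simp add: fixed_point_cone_def)
qed

text \<open>Let a larger cone belong to a point \<open>z\<close> in the charts of \<open>u'\<close>.
  It contains the image of \<open>\<rho>\<close>, so \<open>\<rho>\<close> lies in the cone of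
  \<open>u'\<close> by translation invariance, which forces \<open>u' = u\<close>. Then the cone at
  \<open>z\<close> is bounded by that of \<open>u B\<close>.\<close>

lemma orbit_cone_maximal:
  assumes u: "u permutes {..<n}" and le: "tableau_le n u w"
  shows "orbit_cone n (coset n g) (coset n (perm_mat n u)) \<in> maximal_cones (toric_fan n (coset n
    g))"
proof -
  let ?y = "coset n g" and ?F = "fixing_space n (orbit_closure n (coset n g))"
  let ?\<sigma> = "orbit_cone n ?y (coset n (perm_mat n u))"
  have "orbit_cone n ?y z = ?\<sigma>" if z: "z \<in> orbit_closure n ?y" and sub: "?\<sigma> \<subseteq>
    orbit_cone n ?y z" for z
  proof -
    obtain u' where u': "u' permutes {..<n}" "tableau_le n u' w" and ch: "\<And>k. k \<le> n \<Longrightarrow>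
      z \<in> minor_chart n k u'"
      using closure_point_charts[OF z] by blast
    define \<rho> where "\<rho> = vec n (\<lambda>i. real (perm_inv u i))"
    have \<rho>: "\<rho> \<in> fixed_point_cone n w u" unfolding \<rho>_def by (rule inv_vec_in_fixed_point_cone[OF u])
    then have "quot_proj ?F \<rho> \<in> orbit_cone n ?y z"
      using sub by (auto simp: orbit_cone_eq dual_cone_fixed_point[OF u le])
    then obtain a where a: "a \<in> dual_cone n ?y z" "quot_proj ?F \<rho> = quot_proj ?F a"
      by (auto simp: orbit_cone_eq)
    \<comment> \<open>As 0 lies in the fixing space, \<open>\<rho>\<close> belongs to its own coset;
      equality of the cosets then writes it as \<open>a + b\<close> with \<open>b\<close> in the
      fixing space.\<close>
    have "\<rho> + 0\<^sub>v n \<in> quot_proj ?F \<rho>" unfolding quot_proj_def by (intro imageI fixing_space_zero)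
    moreover have "\<rho> \<in> carrier_vec n" by (simp add: \<rho>_def)
    ultimately obtain b where b: "b \<in> ?F" "\<rho> = a + b" using a(2) by (auto simp: quot_proj_def)
    have "a \<in> fixed_point_cone n w u'" using dual_cone_subset[OF u' z ch] a(1) by blast
    then have "\<rho> \<in> fixed_point_cone n w u'" unfolding b(2)
      by (rule fixed_point_cone_translate[OF u' _ b(1)])
    then have "u' = u" unfolding \<rho>_def
      by (rule inv_vec_in_fixed_point_cone_imp_eq[OF u u'(1) le u'(2)])
    then have "dual_cone n ?y z \<subseteq> fixed_point_cone n w u" using dual_cone_subset[OF u' z ch] by simp
    then have "orbit_cone n ?y z \<subseteq> ?\<sigma>"
      unfolding orbit_cone_eq dual_cone_fixed_point[OF u le] by (rule image_mono)
    with sub show ?thesis by blast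
  qed
  then show ?thesis
    unfolding maximal_cones_def toric_fan_def using perm_in_closure[OF u le] by blast
qed

end

section \<open>From generic orbits to conditions on minors\<close>

text \<open>Any point of the orbit can serve as base point. The bound on minors comes from
  containment in the Schubert variety; the fixed points \<open>u B\<close> lie in that variety, so
  genericity places them in the orbit closure.\<close>

lemma generic_torus_orbit_imp_generic_flag:
  assumes w: "w permutes {..<n}" and gen: "generic_torus_orbit n w \<O>" and y: "y \<in> \<O>"
  shows "\<exists>g. y = coset n g \<and> generic_flag n w g"
proof -
  obtain x where x: "x \<in> flag_variety n" "\<O> = torus_orbit n x"
    and sub: "\<O> \<subseteq> schubert_variety n w"
    and fixed: "{x \<in> schubert_variety n w. \<forall>t\<in>torus n. act t x = x} \<subseteq> flag_topology n closure_of \<O>"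
    using gen unfolding generic_torus_orbit_def by blast
  obtain h where h: "h \<in> GL n" "x = coset n h" using x(1) by (auto simp: flag_variety_def)
  have hc: "h \<in> carrier_mat n n" using h(1) by (simp add: GL_iff)
  obtain t where t: "t \<in> torus n" "y = act t x" using y x(2) by (auto simp: torus_orbit_def)
  obtain d where d: "\<forall>i<n. d i \<noteq> 0" "t = dmat n d" using torus_imp_dmat[OF t(1)] by blast
  define g where "g = dmat n d * h"
  have g: "g \<in> GL n" unfolding g_def using torus_GL[OF t(1)] h(1) d(2) by (simp add: GL_mult)
  have gc: "g \<in> carrier_mat n n" using g by (simp add: GL_iff)
  have yg: "y = coset n g" unfolding t(2) h(2) d(2) g_def by (rule act_coset[OF dmat_carrier hc])
  have "\<O> \<subseteq> torus_orbit n y"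
  proof
    fix z assume "z \<in> \<O>"
    then obtain s where s: "s \<in> torus n" "z = act s x" using x(2) by (auto simp: torus_orbit_def)
    obtain e where e: "\<forall>i<n. e i \<noteq> 0" "s = dmat n e" using torus_imp_dmat[OF s(1)] by blast
    \<comment> \<open>Since \<open>y\<close> is \<open>d\<close> applied to \<open>x\<close> and
      \<open>z\<close> is \<open>e\<close> applied to \<open>x\<close>, the quotient
      \<open>e / d\<close> moves \<open>y\<close> to \<open>z\<close>.\<close>
    have "dmat n (\<lambda>i. e i / d i) * g = dmat n e * h"
      by (rule eq_matI)
        (use hc gc d in \<open>auto simp: g_def index_dmat_mult[OF gc[unfolded g_def]]
          index_dmat_mult[OF hc] simp del: index_mult_mat(1)\<close>)
    then have "z = act (dmat n (\<lambda>i. e i / d i)) y"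
      unfolding yg s(2) h(2) e(2) act_coset[OF dmat_carrier hc] act_coset[OF dmat_carrier gc]
        by simp
    moreover have "dmat n (\<lambda>i. e i / d i) \<in> torus n" using d e by (intro dmat_torus) simp
    ultimately show "z \<in> torus_orbit n y" by (auto simp: torus_orbit_def)
  qed
  then have closure: "flag_topology n closure_of \<O> \<subseteq> orbit_closure n y"
    unfolding orbit_closure_def by (rule closure_of_mono)
  have "generic_flag n w g"
  proof
    show "w permutes {..<n}" by (rule w)
    show "g \<in> GL n" by (rule g)
    show "tuple_le (f ` {..<k}) (w ` {..<k})"
      if "k \<le> n" "f ` {..<k} \<subseteq> {..<n}" "flag_minor k f g \<noteq> 0" for k f
      using schubert_variety_minor_nonzero_imp[OF w g _ that] sub y yg by blast
    show "coset n (perm_mat n u) \<in> orbit_closure n (coset n g)"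
      if "u permutes {..<n}" "tableau_le n u w" for u
      using fixed perm_coset_in_schubert_variety[OF that(1) w that(2)] act_torus_perm_mat[OF
        that(1)]
        closure yg by blast
  qed
  with yg show ?thesis by blast
qed

theorem theorem1p1:
  fixes n :: nat and w u :: "nat \<Rightarrow> nat"
    and \<O> :: "complex mat set set" and y :: "complex mat set"
  assumes "w permutes {..<n}"
    and "generic_torus_orbit n w \<O>" and "y \<in> \<O>"
    and "u permutes {..<n}" and "bruhat_le n u w"
  shows "orbit_cone n y (coset n (perm_mat n u)) \<in> maximal_cones (toric_fan n y) \<and>
         orbit_cone n y (coset n (perm_mat n u)) =
           quot_proj (fixing_space n (orbit_closure n y)) `
             (\<Union>v\<in>{v. v permutes {..<n} \<and> greedy_perm n w v = u}. weyl_chamber n v)"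
proof -
  obtain g where y: "y = coset n g" and "generic_flag n w g"
    using generic_torus_orbit_imp_generic_flag[OF assms(1-3)] by blast
  then interpret generic_flag n w g by simp
  have le: "tableau_le n u w" using assms(5,4) by (rule bruhat_le_tableau_le)
  show ?thesis
    using orbit_cone_maximal[OF assms(4) le] dual_cone_fixed_point[OF assms(4) le]
    by (simp add: y orbit_cone_eq fixed_point_cone_eq_UN_chambers[OF assms(4) le])
qed

end
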